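(* Let $(\mathbb{X},d)$ be a complete separable metric space, and let $\Phi_1,\Phi_2$ be two independent point processes on $\mathbb{X}$ such that the moment measures $M_{\Phi_1},M_{\Phi_2}$ and the second factorial moment measures $M_{\Phi_1^{(2)}},M_{\Phi_2^{(2)}}$ are $\sigma$-finite. Define four measures on $\mathbb{X}^2$ by $$\nu_1(\mathrm{d}x\,\mathrm{d}y)=M_{\Phi_1^{(2)}}(\mathrm{d}x\,\mathrm{d}y),\quad \nu_2(\mathrm{d}x\,\mathrm{d}y)=M_{\Phi_1}(\mathrm{d}x)M_{\Phi_2}(\mathrm{d}y),$$ $$\nu_3(\mathrm{d}x\,\mathrm{d}y)=M_{\Phi_1}(\mathrm{d}y)M_{\Phi_2}(\mathrm{d}x),\quad \nu_4(\mathrm{d}x\,\mathrm{d}y)=M_{\Phi_2^{(2)}}(\mathrm{d}x\,\mathrm{d}y),$$ let $\nu=\nu_1+\nu_2+\nu_3+\nu_4$, and let $q_i=\frac{\mathrm{d}\nu_i}{\mathrm{d}\nu}$ be the Radon--Nikodym derivatives, chosen so that $q_i\geq 0$ and $q_1+q_2+q_3+q_4=1$. Then $\nu=M_{(\Phi_1+\Phi_2)^{(2)}}$ and, for $\nu$-almost all $(x,y)\in\mathbb{X}^2$, the reduced Palm version of $\Phi_1+\Phi_2$ at $(x,y)$ is distributed as the mixture $$(\Phi_1+\Phi_2)^!_{(x,y)}\stackrel{d}{=}\begin{cases}\Phi^!_{1(x,y)}+\Phi_2 & \text{with probability } q_1(x,y),\\ \Phi^!_{1x}+\Phi^!_{2y}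 & \text{with probability } q_2(x,y),\\ \Phi^!_{1y}+\Phi^!_{2x} & \text{with probability } q_3(x,y),\\ \Phi_1+\Phi^!_{2(x,y)} & \text{with probability } q_4(x,y),\end{cases}$$ where in each of the four sums the two summands are independent (terms with $q_i(x,y)=0$ being disregarded).
   Context: Let $\mathcal{X}$ be the Borel $\sigma$-algebra of $\mathbb{X}$. A counting measure is a locally finite measure $\mu$ on $(\mathbb{X},\mathcal{X})$ with $\mu(B)\in\mathbb{N}=\{0,1,2,\dots\}$ for every relatively compact $B\in\mathcal{X}$. $\mathbb{M}_{\mathbb{X}}$ is the set of counting measures and $\mathcal{M}_{\mathbb{X}}$ the smallest $\sigma$-algebra on it making all maps $\mu\mapsto\mu(B)$, $B\in\mathcal{X}$, measurable. A point process is a measurable map $\Phi:(\Omega,\mathcal{A},\mathsf{P})\to(\mathbb{M}_{\mathbb{X}},\mathcal{M}_{\mathbb{X}})$ from a probability space. It can be written $\Phi=\sum_j\delta_{X_j}$ with a measurable enumeration $(X_j)$ of its atoms (repeated according to multiplicity). Its (first) moment measure is $M_\Phi(B)=\mathsf{E}[\Phi(B)]$, $B\in\mathcal{X}$. Its second factorial measure is $\Phi^{(2)}=\sum_{j\neq m}\delta_{(X_j,X_m)}$ (sum over ordered pairs of distinct indices), and its second factorial moment measure is $M_{\Phi^{(2)}}(A)=\mathsf{E}[\Phi^{(2)}(A)]$ for $A$ Borel in $\mathbb{X}^2$. One-point Palm: if $M_\Phi$ is $\sigma$-finite, a family of Palm distributions of $\Phi$ is a probability kernel $x\mapsto\mathsf{P}_\Phi^x$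 from $\mathbb{X}$ to $\mathbb{M}_{\mathbb{X}}$ with $\mathsf{E}[\Phi(B)\mathbf{1}_L(\Phi)]=\int_B\mathsf{P}_\Phi^x(L)\,M_\Phi(\mathrm{d}x)$ for all $B\in\mathcal{X}$, $L\in\mathcal{M}_{\mathbb{X}}$. For $\Phi_x\sim\mathsf{P}_\Phi^x$ it is known that $\Phi_x(\{x\})\ge1$ almost surely for $M_\Phi$-almost all $x$, and $\Phi_x^!:=\Phi_x-\delta_x$ is called the reduced Palm version of $\Phi$ at $x$. Two-point reduced Palm: if $M_{\Phi^{(2)}}$ is $\sigma$-finite, the reduced Palm version $\Phi^!_{(x,y)}$ of $\Phi$ at $(x,y)$ is a point process whose law $\mathsf{P}_\Phi^{!(x,y)}$ is given by a probability kernel from $\mathbb{X}^2$ to $\mathbb{M}_{\mathbb{X}}$ satisfying $$\mathsf{E}\Big[\int_A\mathbf{1}_L(\Phi-\delta_x-\delta_y)\,\Phi^{(2)}(\mathrm{d}x\,\mathrm{d}y)\Big]=\int_A\mathsf{P}_\Phi^{!(x,y)}(L)\,M_{\Phi^{(2)}}(\mathrm{d}x\,\mathrm{d}y)$$ for all Borel $A\subseteq\mathbb{X}^2$ and $L\in\mathcal{M}_{\mathbb{X}}$. Such kernels are determined up to null sets of the corresponding (factorial) moment measure; fix any versions for $\Phi_1,\Phi_2,\Phi_1+\Phi_2$. *)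

theory Defs
  imports "HOL-Probability.Probability"
begin

definition add_measure :: "'a measure \<Rightarrow> 'a measure \<Rightarrow> 'a measure"  (infixl "\<oplus>\<^sub>M" 65)
  where "M \<oplus>\<^sub>M N = measure_of (space M) (sets M) (\<lambda>A. emeasure M A + emeasure N A)"

lemma space_add_measure [simp]: "space (M \<oplus>\<^sub>M N) = space M"
  and sets_add_measure [simp, measurable_cong]: "sets (M \<oplus>\<^sub>M N) = sets M"
  by (auto simp: add_measure_def)

lemma emeasure_add_measure:
  assumes "sets M = sets N" "A \<in> sets M"
  shows "emeasure (M \<oplus>\<^sub>M N) A = emeasure M A + emeasure N A"
  unfolding add_measure_def
proof (rule emeasure_measure_of_sigma)
  show "sigma_algebra (space M) (sets M)" ..
  show "positive (sets M) (\<lambda>A. emeasure M A + emeasure N A)"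
    by (simp add: positive_def)
  show "countably_additive (sets M) (\<lambda>A. emeasure M A + emeasure N A)"
    using assms(1) by (auto simp: countably_additive_def suminf_add[symmetric] suminf_emeasure)
qed (fact assms)

(* Local finiteness means that every point has a neighbourhood of finite measure.  This matters
   because the space need not be locally compact: finiteness on compact sets alone would admit
   measures that are not sums of Dirac measures. *)
definition counting_measures :: "'a::topological_space measure set" where
  "counting_measures = {\<mu>. sets \<mu> = sets borel
     \<and> (\<forall>x. \<exists>U. open U \<and> x \<in> U \<and> emeasure \<mu> U < \<infinity>)
     \<and> (\<forall>B\<in>sets borel. compact (closure B) \<longrightarrow> emeasure \<mu> B \<in> \<nat>)}"

definition counting_measure_algebra :: "'a::topological_space measure measure" where
  "counting_measure_algebra =
     (SUP B \<in> sets borel. vimage_algebra counting_measures (\<lambda>\<mu>. emeasure \<mu> B) borel)"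

lemma space_counting_measure_algebra: "space counting_measure_algebra = counting_measures"
  by (auto simp: counting_measure_algebra_def space_Sup_eq_UN)

definition point_process :: "'w measure \<Rightarrow> ('w \<Rightarrow> 'a::topological_space measure) \<Rightarrow> bool" where
  "point_process P \<Phi> \<longleftrightarrow> prob_space P \<and> \<Phi> \<in> P \<rightarrow>\<^sub>M counting_measure_algebra"

definition moment_measure ::
    "'w measure \<Rightarrow> ('w \<Rightarrow> 'a::topological_space measure) \<Rightarrow> 'a measure" where
  "moment_measure P \<Phi> = measure_of UNIV (sets borel) (\<lambda>B. \<integral>\<^sup>+\<omega>. emeasure (\<Phi> \<omega>) B \<partial>P)"

(* The atoms of \<mu>, repeated according to multiplicity, are x j for j in J: the pushforward of the
   counting measure on J under x is the sum of the Dirac measures at the points x j. *)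
definition enumerates_atoms ::
    "nat set \<times> (nat \<Rightarrow> 'a) \<Rightarrow> 'a::topological_space measure \<Rightarrow> bool" where
  "enumerates_atoms = (\<lambda>(J, x) \<mu>. \<mu> = distr (count_space J) borel x)"

(* The sum of the Dirac measures at (x j, x m) over ordered pairs of distinct indices.  It does not
   depend on the enumeration that is chosen. *)
definition second_factorial_measure ::
    "'a::topological_space measure \<Rightarrow> ('a \<times> 'a) measure" where
  "second_factorial_measure \<mu> =
     (let (J, x) = (SOME e. enumerates_atoms e \<mu>)
      in distr (count_space {(j, m). j \<in> J \<and> m \<in> J \<and> j \<noteq> m}) borel (\<lambda>(j, m). (x j, x m)))"

definition second_factorial_moment_measure ::
    "'w measure \<Rightarrow> ('w \<Rightarrow> 'a::topological_space measure) \<Rightarrow> ('a \<times> 'a) measure" where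
  "second_factorial_moment_measure P \<Phi> =
     measure_of UNIV (sets borel) (\<lambda>A. \<integral>\<^sup>+\<omega>. emeasure (second_factorial_measure (\<Phi> \<omega>)) A \<partial>P)"

definition is_palm_kernel ::
    "'w measure \<Rightarrow> ('w \<Rightarrow> 'a measure) \<Rightarrow> ('a::topological_space \<Rightarrow> 'a measure measure) \<Rightarrow> bool" where
  "is_palm_kernel P \<Phi> K \<longleftrightarrow>
     K \<in> borel \<rightarrow>\<^sub>M prob_algebra counting_measure_algebra \<and>
     (\<forall>B\<in>sets borel. \<forall>L\<in>sets counting_measure_algebra.
        (\<integral>\<^sup>+\<omega>. emeasure (\<Phi> \<omega>) B * indicator L (\<Phi> \<omega>) \<partial>P)
          = (\<integral>\<^sup>+x\<in>B. emeasure (K x) L \<partial>moment_measure P \<Phi>))"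

(* Only meaningful if \<mu> has an atom at x; otherwise a non-zero counting measure is sent to the
   zero measure, since the truncated difference is then not additive. *)
definition remove_point :: "'a \<Rightarrow> 'a::topological_space measure \<Rightarrow> 'a measure" where
  "remove_point x \<mu> = diff_measure \<mu> (return borel x)"

definition reduced_palm ::
    "('a::topological_space \<Rightarrow> 'a measure measure) \<Rightarrow> 'a \<Rightarrow> 'a measure measure" where
  "reduced_palm K x = distr (K x) counting_measure_algebra (remove_point x)"

definition is_reduced_palm_kernel2 ::
    "'w measure \<Rightarrow> ('w \<Rightarrow> 'a measure) \<Rightarrow> ('a::topological_space \<times> 'a \<Rightarrow> 'a measure measure) \<Rightarrow> bool"
  where
  "is_reduced_palm_kernel2 P \<Phi> K \<longleftrightarrow>
     K \<in> borel \<rightarrow>\<^sub>M prob_algebra counting_measure_algebra \<and>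
     (\<forall>A\<in>sets borel. \<forall>L\<in>sets counting_measure_algebra.
        (\<integral>\<^sup>+\<omega>. (\<integral>\<^sup>+z\<in>A. indicator L (remove_point (snd z) (remove_point (fst z) (\<Phi> \<omega>)))
                  \<partial>second_factorial_measure (\<Phi> \<omega>)) \<partial>P)
          = (\<integral>\<^sup>+z\<in>A. emeasure (K z) L \<partial>second_factorial_moment_measure P \<Phi>))"

(* The law of the sum of two independent point processes with laws Q and R. *)
definition indep_sum_law ::
    "'a::topological_space measure measure \<Rightarrow> 'a measure measure \<Rightarrow> 'a measure measure" where
  "indep_sum_law Q R = distr (Q \<Otimes>\<^sub>M R) counting_measure_algebra (\<lambda>(\<mu>, \<mu>'). \<mu> \<oplus>\<^sub>M \<mu>')"

end

theory Submission
  imports Defs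
begin

text \<open>
  Every integral against the second factorial measure is rewritten as
  \<open>\<integral>\<integral> g (x, y) (\<mu> - \<delta>\<^sub>x)(dy) \<mu>(dx)\<close>.  In this form the superposition of two counting measures
  splits by the origin of \<open>x\<close> and then of \<open>y\<close>, because removing an atom of \<open>\<mu>\<close> from
  \<open>\<mu> + \<nu>\<close> leaves \<open>\<nu>\<close> untouched.  Taking expectations, independence and the Palm formulas turn the
  four terms into integrals of the four independent-sum laws against \<open>\<nu>1\<close>, ..., \<open>\<nu>4\<close>.  The densities
  \<open>q1\<close>, ..., \<open>q4\<close> then identify the kernel for each fixed event, and since the algebra on counting
  measures is countably generated the exceptional null set can be chosen independently of the event.

  Two points need care.  The space is not assumed locally compact, so there is no fixed exhaustion by
  sets of finite measure; a fixed countable family of open sets contains one for each counting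
  measure, and a supremum over that family replaces it in all measurability arguments.  Enumerations
  of atoms exist because inner regularity makes all finite values integers, so that points without
  mass have null neighbourhoods.
\<close>

section \<open>Counting measures and their atoms\<close>

text \<open>\<open>second_factorial_measure\<close> selects an enumeration by \<open>SOME\<close>,
  and nothing makes that choice measurable in the measure. The iterated integral removes the choice,
  so that measurability and the effect of adding a second measure can be checked for
  \<open>remove_point\<close> alone. Since \<open>remove_point\<close> is a total function, its
  value away from atoms has to be known as well; it is the zero measure. The hypotheses on the Palm
  kernels only concern products of indicators, while the configuration left after a removal is
  combined with another random configuration. The formulas are therefore extended to all nonnegative
  functions \<open>g z \<mu>\<close> of point and configuration jointly; this is where
  sigma-finiteness of the moment measures is used, besides exchanges of integrals and uniqueness of
  densities. One identity for such \<open>g\<close> gives both claims: integrands depending on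
  \<open>z\<close> alone identify the moment measure, products of indicators identify the kernel.
  Sigma-finiteness of the second factorial moment measure of the superposition is thus a consequence
  and not a hypothesis.\<close>

abbreviation (input) CM :: "'a::topological_space measure measure" where
  "CM \<equiv> counting_measure_algebra"

lemma counting_measuresD:
  assumes "\<mu> \<in> counting_measures"
  shows "sets \<mu> = sets borel" "space \<mu> = UNIV"
    "\<exists>U. open U \<and> x \<in> U \<and> emeasure \<mu> U < \<infinity>"
    "B \<in> sets borel \<Longrightarrow> compact (closure B) \<Longrightarrow> emeasure \<mu> B \<in> \<nat>"
  using assms sets_eq_imp_space_eq[of \<mu> borel] by (auto simp: counting_measures_def)

lemma counting_measures_if_space_CM: "\<mu> \<in> space CM \<Longrightarrow> \<mu> \<in> counting_measures"
  by (simp add: space_counting_measure_algebra)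

lemma measurable_into_CM:
  assumes "\<And>w. w \<in> space N \<Longrightarrow> f w \<in> counting_measures"
    and "\<And>B. B \<in> sets borel \<Longrightarrow> (\<lambda>w. emeasure (f w) B) \<in> borel_measurable N"
  shows "f \<in> N \<rightarrow>\<^sub>M CM"
  unfolding counting_measure_algebra_def using assms
  by (intro measurable_SUP2 measurable_vimage_algebra2) (auto intro!: exI[of _ "{}"])

lemma measurable_emeasure_CM [measurable (raw)]:
  fixes f :: "'w \<Rightarrow> 'a::topological_space measure"
  assumes f: "f \<in> N \<rightarrow>\<^sub>M CM" and B: "B \<in> sets borel"
  shows "(\<lambda>w. emeasure (f w) B) \<in> borel_measurable N"
proof -
  have "(\<lambda>\<mu>::'a measure. emeasure \<mu> B) \<in> borel_measurable CM"
    unfolding counting_measure_algebra_def using B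
    by (intro measurable_Sup1[where m="vimage_algebra counting_measures (\<lambda>\<mu>. emeasure \<mu> B) borel"]
        measurable_vimage_algebra1) auto
  with f show ?thesis by measurable
qed

text \<open>Finite intersections of basic sets give a family closed under intersection, as
  Dynkin-class arguments require; finite unions of these remain countable in number and let an
  exhaustion be chosen increasing. For a given \<open>\<mu>\<close> the basic sets of finite mass
  already cover the space by local finiteness, so the unions of their initial segments serve as
  \<open>W\<close>.\<close>

lemma countable_exhausting_family:
  obtains \<V> :: "'a::second_countable_topology set set" where
    "countable \<V>" "Int_stable \<V>" "UNIV \<in> \<V>" "sets borel = sigma_sets UNIV \<V>"
    "\<And>\<mu>. \<mu> \<in> counting_measures \<Longrightarrow>
       \<exists>W::nat \<Rightarrow> 'a set. range W \<subseteq> \<V> \<and> incseq W \<and> (\<Union>n. W n) = UNIV \<and> (\<forall>n. emeasure \<mu> (W n) < \<infinity>)"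
proof -
  obtain B :: "'a set set" where B: "countable B" "topological_basis B"
    using ex_countable_basis by blast
  define X where "X = Inter ` {F. finite F \<and> F \<subseteq> B}"
  define V where "V = Union ` {F. finite F \<and> F \<subseteq> X}"
  have X: "A \<inter> A' \<in> X" if "A \<in> X" "A' \<in> X" for A A'
  proof -
    from that obtain F G where "finite F" "F \<subseteq> B" "A = \<Inter>F" "finite G" "G \<subseteq> B" "A' = \<Inter>G"
      unfolding X_def by auto
    then show ?thesis
      unfolding X_def by (auto intro!: image_eqI[of _ _ "F \<union> G"])
  qed
  have "Int_stable V"
  proof (rule Int_stableI)
    fix A A' assume "A \<in> V" "A' \<in> V"
    then obtain F G where FG: "finite F" "F \<subseteq> X" "A = \<Union>F" "finite G" "G \<subseteq> X" "A' = \<Union>G"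
      unfolding V_def by auto
    have "A \<inter> A' = \<Union>((\<lambda>(a, b). a \<inter> b) ` (F \<times> G))"
      using FG by auto
    moreover have "(\<lambda>(a, b). a \<inter> b) ` (F \<times> G) \<subseteq> X"
      using FG X by auto
    ultimately show "A \<inter> A' \<in> V"
      unfolding V_def using FG by blast
  qed
  moreover have "countable X"
    unfolding X_def using B by (intro countable_image countable_Collect_finite_subset)
  then have "countable V"
    unfolding V_def by (intro countable_image countable_Collect_finite_subset)
  moreover have BX: "B \<subseteq> X"
  proof
    fix b assume "b \<in> B" then show "b \<in> X"
      unfolding X_def by (intro image_eqI[of _ _ "{b}"]) auto
  qed
  have XV: "X \<subseteq> V"
  proof
    fix b assume "b \<in> X" then show "b \<in> V"
      unfolding V_def by (intro image_eqI[of _ _ "{b}"]) auto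
  qed
  have "UNIV \<in> X"
    unfolding X_def by (intro image_eqI[of _ _ "{}"]) auto
  then have "UNIV \<in> V" using XV by auto
  moreover have "sets borel = sigma_sets UNIV V"
  proof
    have "sets borel = sigma_sets UNIV B"
      by (subst borel_eq_countable_basis[OF B]) (simp add: sets_measure_of_conv)
    also have "\<dots> \<subseteq> sigma_sets UNIV V"
      using BX XV by (intro sigma_sets_mono') auto
    finally show "sets borel \<subseteq> sigma_sets UNIV V" .
    have bo: "b \<in> B \<Longrightarrow> open b" for b using B(2) by (rule topological_basis_open)
    have "x \<in> X \<Longrightarrow> open x" for x
      unfolding X_def using bo by (auto intro!: open_Inter)
    then have "v \<in> V \<Longrightarrow> open v" for v
      unfolding V_def by auto
    then show "sigma_sets UNIV V \<subseteq> sets borel"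
      by (metis borel_open sets.sigma_sets_subset space_borel subsetI)
  qed
  moreover have "\<exists>W::nat \<Rightarrow> 'a set. range W \<subseteq> V \<and> incseq W \<and> (\<Union>n. W n) = UNIV \<and> (\<forall>n. emeasure \<mu> (W n) < \<infinity>)"
    if \<mu>: "\<mu> \<in> counting_measures" for \<mu> :: "'a measure"
  proof -
    note [simp] = counting_measuresD(1)[OF \<mu>]
    define B' where "B' = {b\<in>B. emeasure \<mu> b < \<infinity>}"
    have cov: "\<exists>b\<in>B'. x \<in> b" for x
    proof -
      obtain U where U: "open U" "x \<in> U" "emeasure \<mu> U < \<infinity>"
        using counting_measuresD(3)[OF \<mu>] by blast
      obtain b where b: "b \<in> B" "x \<in> b" "b \<subseteq> U"
        using topological_basisE[OF B(2) U(1,2)] by blast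
      have "emeasure \<mu> b \<le> emeasure \<mu> U"
        using b U by (intro emeasure_mono) auto
      with U b show ?thesis by (auto simp: B'_def intro: le_less_trans)
    qed
    then have ne: "B' \<noteq> {}" by auto
    have cB: "countable B'" using B by (auto simp: B'_def)
    \<comment> \<open>If \<open>B'\<close> is finite, \<open>from_nat_into\<close> repeats members;
      only the union over all indices matters.\<close>
    let ?W = "\<lambda>n. \<Union>(from_nat_into B' ` {..n})"
    have mem: "from_nat_into B' i \<in> B'" for i using from_nat_into[OF ne] .
    show ?thesis
    proof (intro exI conjI allI)
      show "range ?W \<subseteq> V"
      proof
        fix w assume "w \<in> range ?W"
        then obtain n where "w = ?W n" by auto
        moreover have "from_nat_into B' ` {..n} \<subseteq> X"
          using mem BX by (auto simp: B'_def)
        ultimately show "w \<in> V"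
          unfolding V_def by blast
      qed
      show "incseq ?W" by (rule incseq_SucI) (auto simp: atMost_Suc)
      show "(\<Union>n. ?W n) = UNIV"
      proof -
        have "x \<in> (\<Union>n. ?W n)" for x
        proof -
          obtain b where "b \<in> B'" "x \<in> b" using cov by blast
          then show ?thesis using from_nat_into_surj[OF cB, of b] by auto
        qed
        then show ?thesis by auto
      qed
      fix n
      have op: "from_nat_into B' i \<in> sets \<mu>" "emeasure \<mu> (from_nat_into B' i) < \<infinity>" for i
        using mem[of i] B(2) by (auto simp: B'_def topological_basis_open)
      have "emeasure \<mu> (?W n) \<le> (\<Sum>i\<le>n. emeasure \<mu> (from_nat_into B' i))"
        using op by (intro emeasure_subadditive_finite) auto
      also have "\<dots> < \<infinity>" using op by simp
      finally show "emeasure \<mu> (?W n) < \<infinity>" .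
    qed
  qed
  ultimately show thesis using that by blast
qed

text \<open>Integrality is granted by definition only for relatively compact sets. By inner
  regularity a set of finite mass is approximated from inside by compact sets; their masses are
  naturals with a common bound, so the supremum is attained and is itself a natural number.\<close>

lemma emeasure_counting_measure_nat:
  fixes \<mu> :: "'a::polish_space measure"
  assumes \<mu>: "\<mu> \<in> counting_measures" and B: "B \<in> sets borel" and fin: "emeasure \<mu> B < \<infinity>"
  shows "emeasure \<mu> B \<in> \<nat>"
proof -
  note sets[simp] = counting_measuresD(1,2)[OF \<mu>]
  \<comment> \<open>Inner regularity concerns measures of finite total mass, hence the restriction
    to \<open>B\<close>; for compact subsets of \<open>B\<close> the restriction changes
    nothing.\<close>
  let ?M = "density \<mu> (indicator B)"
  let ?K = "{K. K \<subseteq> B \<and> compact K}"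
  have M: "emeasure ?M A = emeasure \<mu> (B \<inter> A)" if "A \<in> sets borel" for A
    using B that by (subst emeasure_restricted) auto
  have Kb: "K \<in> sets borel" if "compact K" for K :: "'a set"
    using that compact_imp_closed by (intro borel_closed)
  have "emeasure ?M B = (SUP K\<in>?K. emeasure ?M K)"
    by (rule inner_regular) (use B fin M[of UNIV] in auto)
  also have "\<dots> = (SUP K\<in>?K. emeasure \<mu> K)"
    by (intro SUP_cong) (auto simp: M Kb Int_absorb1)
  finally have sup: "emeasure \<mu> B = (SUP K\<in>?K. emeasure \<mu> K)"
    using M[OF B] by simp
  let ?N = "{k. \<exists>K\<in>?K. emeasure \<mu> K = of_nat k}"
  obtain r where r: "emeasure \<mu> B = ennreal r" "0 \<le> r"
    using fin by (cases "emeasure \<mu> B") auto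
  have le: "emeasure \<mu> K \<le> emeasure \<mu> B" if "K \<in> ?K" for K
    using that B by (intro emeasure_mono) auto
  have "?N \<subseteq> {..nat \<lceil>r\<rceil>}"
  proof
    fix k assume "k \<in> ?N"
    then obtain K where "K \<in> ?K" "emeasure \<mu> K = of_nat k" by blast
    then have "of_nat k \<le> ennreal r" using le[of K] r by simp
    then have "real k \<le> r" using r by (simp add: ennreal_of_nat_eq_real_of_nat)
    then show "k \<in> {..nat \<lceil>r\<rceil>}" using real_nat_ceiling_ge[of r] by simp linarith
  qed
  then have finN: "finite ?N" by (rule finite_subset) simp
  have "{} \<in> ?K" "emeasure \<mu> {} = of_nat 0" by auto
  then have ne: "?N \<noteq> {}" by blast
  have "emeasure \<mu> K \<le> of_nat (Max ?N)" if K: "K \<in> ?K" for K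
  proof -
    have "emeasure \<mu> K \<in> \<nat>"
      using K Kb by (intro counting_measuresD(4)[OF \<mu>]) (auto simp: compact_imp_closed)
    then obtain k where k: "emeasure \<mu> K = of_nat k" by (auto elim: Nats_cases)
    then have "k \<le> Max ?N" using finN K by (intro Max_ge) auto
    then show ?thesis by (simp add: k)
  qed
  then have "emeasure \<mu> B \<le> of_nat (Max ?N)"
    unfolding sup by (rule SUP_least)
  moreover have "of_nat (Max ?N) \<le> emeasure \<mu> B"
  proof -
    obtain K where "K \<in> ?K" "emeasure \<mu> K = of_nat (Max ?N)"
      using Max_in[OF finN ne] by blast
    with le[of K] show ?thesis by simp
  qed
  ultimately have "emeasure \<mu> B = of_nat (Max ?N)" by (rule antisym)
  then show ?thesis by (simp only: of_nat_in_Nats)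
qed

section \<open>Atoms of a counting measure and their enumeration\<close>

lemma counting_measure_singleton:
  fixes \<mu> :: "'a::polish_space measure"
  assumes \<mu>: "\<mu> \<in> counting_measures"
  shows "emeasure \<mu> {x} < \<infinity>" "emeasure \<mu> {x} \<in> \<nat>"
proof -
  note [simp] = counting_measuresD(1,2)[OF \<mu>]
  obtain U where U: "open U" "x \<in> U" "emeasure \<mu> U < \<infinity>"
    using counting_measuresD(3)[OF \<mu>] by blast
  then have "emeasure \<mu> {x} \<le> emeasure \<mu> U" by (intro emeasure_mono) auto
  with U show "emeasure \<mu> {x} < \<infinity>" by (auto intro: le_less_trans)
  then show "emeasure \<mu> {x} \<in> \<nat>"
    by (intro emeasure_counting_measure_nat[OF \<mu>]) auto
qed

text \<open>Shrinking balls inside a neighbourhood of finite mass decrease to \<open>{x}\<close>, so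
  their masses tend to 0 by continuity from above. Integrality turns a mass below 1 into mass 0,
  which excludes a diffuse part.\<close>

lemma null_neighbourhood:
  fixes \<mu> :: "'a::polish_space measure"
  assumes \<mu>: "\<mu> \<in> counting_measures" and x: "emeasure \<mu> {x} = 0"
  obtains U where "open U" "x \<in> U" "emeasure \<mu> U = 0"
proof -
  note [simp] = counting_measuresD(1,2)[OF \<mu>]
  obtain U where U: "open U" "x \<in> U" "emeasure \<mu> U < \<infinity>"
    using counting_measuresD(3)[OF \<mu>] by blast
  let ?A = "\<lambda>n. U \<inter> ball x (inverse (real (Suc n)))"
  have fin: "emeasure \<mu> (?A n) < \<infinity>" for n
  proof -
    have "emeasure \<mu> (?A n) \<le> emeasure \<mu> U" using U by (intro emeasure_mono) auto
    with U show ?thesis by (auto intro: le_less_trans)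
  qed
  have "(INF n. emeasure \<mu> (?A n)) = emeasure \<mu> (\<Inter>n. ?A n)"
  proof (rule INF_emeasure_decseq)
    show "range ?A \<subseteq> sets \<mu>" using U by auto
    show "decseq ?A"
    proof (rule decseq_SucI)
      fix n
      have "inverse (real (Suc (Suc n))) \<le> inverse (real (Suc n))"
        by (intro le_imp_inverse_le) auto
      then show "?A (Suc n) \<subseteq> ?A n" using subset_ball by blast
    qed
    show "emeasure \<mu> (?A i) \<noteq> \<infinity>" for i using fin[of i] by simp
  qed
  also have "(\<Inter>n. ?A n) = {x}"
  proof -
    have "y = x" if "y \<in> (\<Inter>n. ?A n)" for y
    proof (rule ccontr)
      assume "y \<noteq> x"
      then have "0 < dist x y" by simp
      then obtain n where "inverse (real (Suc n)) < dist x y"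
        using reals_Archimedean by blast
      moreover have "y \<in> ball x (inverse (real (Suc n)))" using that by blast
      ultimately show False by simp
    qed
    then show ?thesis using U by auto
  qed
  finally have "(INF n. emeasure \<mu> (?A n)) < 1" using x by simp
  then obtain n where n: "emeasure \<mu> (?A n) < 1"
    by (auto simp: INF_less_iff)
  have "emeasure \<mu> (?A n) \<in> \<nat>"
    using fin[of n] U by (intro emeasure_counting_measure_nat[OF \<mu>]) auto
  then obtain k where k: "emeasure \<mu> (?A n) = of_nat k" by (auto elim: Nats_cases)
  have "k = 0"
  proof (rule ccontr)
    assume "k \<noteq> 0"
    then have "(1::ennreal) \<le> of_nat k"
      by (metis One_nat_def Suc_leI neq0_conv of_nat_1 of_nat_mono)
    with n k show False by simp
  qed
  with k have "emeasure \<mu> (?A n) = 0" by simp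
  then show thesis using U by (intro that[of "?A n"]) auto
qed

text \<open>A finite measure has only countably many points of positive mass; this is applied to the
  restrictions of \<open>\<mu>\<close> to an exhaustion by sets of finite mass.\<close>

lemma countable_atoms:
  fixes \<mu> :: "'a::polish_space measure"
  assumes \<mu>: "\<mu> \<in> counting_measures"
  shows "countable {x. emeasure \<mu> {x} \<noteq> 0}"
proof -
  note [simp] = counting_measuresD(1,2)[OF \<mu>]
  obtain \<V> :: "'a set set" where \<V>: "sets borel = sigma_sets UNIV \<V>" and
    "\<And>\<mu>. \<mu> \<in> counting_measures \<Longrightarrow>
       \<exists>W::nat \<Rightarrow> 'a set. range W \<subseteq> \<V> \<and> incseq W \<and> (\<Union>n. W n) = UNIV \<and> (\<forall>n. emeasure \<mu> (W n) < \<infinity>)"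
    by (rule countable_exhausting_family) blast
  with \<mu> obtain W :: "nat \<Rightarrow> 'a set" where
    W: "range W \<subseteq> \<V>" "incseq W" "(\<Union>n. W n) = UNIV" "\<And>n. emeasure \<mu> (W n) < \<infinity>"
    by metis
  have Wb: "W n \<in> sets borel" for n using W(1) \<V> by auto
  have "countable {x. measure (density \<mu> (indicator (W n))) {x} \<noteq> 0}" for n
  proof (rule finite_measure.countable_support)
    show "finite_measure (density \<mu> (indicator (W n)))"
      by (rule finite_measureI) (use W(4)[of n] Wb in \<open>simp add: emeasure_restricted\<close>)
  qed
  moreover have "{x. emeasure \<mu> {x} \<noteq> 0} \<subseteq> (\<Union>n. {x. measure (density \<mu> (indicator (W n))) {x} \<noteq> 0})"
  proof
    fix x assume x: "x \<in> {x. emeasure \<mu> {x} \<noteq> 0}"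
    obtain n where n: "x \<in> W n" using W(3) by auto
    then have "emeasure (density \<mu> (indicator (W n))) {x} = emeasure \<mu> {x}"
      using Wb by (simp add: emeasure_restricted Int_absorb1)
    then have "measure (density \<mu> (indicator (W n))) {x} \<noteq> 0"
      using x counting_measure_singleton(1)[OF \<mu>, of x] by (simp add: measure_def enn2real_eq_0_iff)
    then show "x \<in> (\<Union>n. {x. measure (density \<mu> (indicator (W n))) {x} \<noteq> 0})" by auto
  qed
  ultimately show ?thesis by (meson countable_UN countable_subset countableI_type)
qed

text \<open>The points without mass may be uncountably many, so that nullity of single points proves
  nothing. Their null neighbourhoods are open, and by the Lindelof property countably many of them
  suffice.\<close>

lemma AE_atom:
  fixes \<mu> :: "'a::polish_space measure"
  assumes \<mu>: "\<mu> \<in> counting_measures"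
  shows "AE x in \<mu>. emeasure \<mu> {x} \<noteq> 0"
proof -
  note [simp] = counting_measuresD(1,2)[OF \<mu>]
  let ?F = "{U. open U \<and> emeasure \<mu> U = 0}"
  obtain G where G: "G \<subseteq> ?F" "countable G" "\<Union>G = \<Union>?F"
    by (rule Lindelof[of ?F]) auto
  have "U \<in> null_sets \<mu>" if "U \<in> G" for U
    using subsetD[OF G(1) that] by (simp add: null_sets_def)
  with G(2) have "(\<Union>U\<in>G. U) \<in> null_sets \<mu>"
    by (rule null_sets_UN')
  then have "\<Union>G \<in> null_sets \<mu>" by simp
  moreover have "{x \<in> space \<mu>. \<not> emeasure \<mu> {x} \<noteq> 0} \<subseteq> \<Union>G"
  proof
    fix x assume "x \<in> {x \<in> space \<mu>. \<not> emeasure \<mu> {x} \<noteq> 0}"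
    then obtain U where "open U" "x \<in> U" "emeasure \<mu> U = 0"
      using null_neighbourhood[OF \<mu>, of x] by auto
    then show "x \<in> \<Union>G" unfolding G(3) by blast
  qed
  ultimately show ?thesis by (rule AE_I')
qed

text \<open>An atom of mass \<open>m x\<close> is listed \<open>m x\<close> times by using the pairs
  \<open>(x, i)\<close> with \<open>i < m x\<close> as indices. There are countably many such pairs,
  and an injection into the naturals brings them into the form that \<open>enumerates_atoms\<close>
  asks for. The zero measure gets the empty index set.\<close>

lemma ex_enumerates_atoms:
  fixes \<mu> :: "'a::polish_space measure"
  assumes \<mu>: "\<mu> \<in> counting_measures"
  shows "\<exists>e. enumerates_atoms e \<mu>"
proof -
  note [simp] = counting_measuresD(1,2)[OF \<mu>]
  let ?S = "{x. emeasure \<mu> {x} \<noteq> 0}"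
  have cS: "countable ?S" by (rule countable_atoms[OF \<mu>])
  have Sb: "A \<inter> ?S \<in> sets borel" for A
    by (rule sets.countable[of "A \<inter> ?S" borel]) (use cS in \<open>auto\<close>)
  have "\<forall>x. \<exists>m. emeasure \<mu> {x} = of_nat m"
    using counting_measure_singleton(2)[OF \<mu>] by (metis Nats_cases)
  then obtain m where m: "\<And>x. emeasure \<mu> {x} = of_nat (m x)" by metis
  let ?I = "SIGMA x:?S. {..<m x}"
  have I: "countable ?I" using cS by auto
  let ?J = "to_nat_on ?I ` ?I"
  let ?e = "\<lambda>j. fst (from_nat_into ?I j)"
  have bij: "bij_betw (from_nat_into ?I) ?J ?I"
    using I by (auto simp: bij_betw_def inj_on_def image_image)
  have "\<mu> = distr (count_space ?I) borel fst"
  proof (rule measure_eqI)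
    fix B assume "B \<in> sets \<mu>"
    then have B: "B \<in> sets borel" by simp
    have "emeasure (distr (count_space ?I) borel fst) B
        = (\<integral>\<^sup>+p. indicator B (fst p) \<partial>count_space ?I)"
      using B by (subst nn_integral_indicator[symmetric]) (auto simp: nn_integral_distr simp del: nn_integral_indicator)
    also have "\<dots> = (\<integral>\<^sup>+p. indicator B (fst p) * indicator ?I p \<partial>count_space UNIV)"
      by (subst nn_integral_count_space_indicator) auto
    also have "\<dots> = (\<integral>\<^sup>+x. \<integral>\<^sup>+i. indicator B x * indicator ?I (x, i) \<partial>count_space UNIV \<partial>count_space UNIV)"
      by (subst nn_integral_fst_count_space[symmetric]) simp
    also have "\<dots> = (\<integral>\<^sup>+x. emeasure \<mu> {x} * indicator (B \<inter> ?S) x \<partial>count_space UNIV)"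
    proof (intro nn_integral_cong)
      fix x :: 'a
      have "(\<integral>\<^sup>+i. indicator B x * indicator ?I (x, i) \<partial>count_space UNIV)
          = (\<integral>\<^sup>+i. indicator (B \<inter> ?S) x * indicator {..<m x} i \<partial>count_space UNIV)"
        by (intro nn_integral_cong) (auto split: split_indicator)
      also have "\<dots> = emeasure \<mu> {x} * indicator (B \<inter> ?S) x"
        by (cases "x \<in> B \<inter> ?S") (simp_all add: m)
      finally show "(\<integral>\<^sup>+i. indicator B x * indicator ?I (x, i) \<partial>count_space UNIV) = \<dots>" .
    qed
    also have "\<dots> = (\<integral>\<^sup>+x. emeasure \<mu> {x} \<partial>count_space (B \<inter> ?S))"
      by (subst (2) nn_integral_count_space_indicator) auto
    also have "\<dots> = emeasure \<mu> (B \<inter> ?S)"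
      using cS by (intro emeasure_countable_singleton[symmetric]) auto
    \<comment> \<open>The atoms carry the whole mass, so nothing is lost by intersecting with the
      countable set \<open>?S\<close>.\<close>
    also have "\<dots> = emeasure \<mu> B"
      using AE_atom[OF \<mu>] B Sb by (intro emeasure_eq_AE) auto
    finally show "emeasure \<mu> B = emeasure (distr (count_space ?I) borel fst) B" by simp
  qed simp
  also have "\<dots> = distr (distr (count_space ?J) (count_space ?I) (from_nat_into ?I)) borel fst"
    by (simp add: distr_bij_count_space[OF bij])
  also have "\<dots> = distr (count_space ?J) borel ?e"
    using bij by (subst distr_distr) (auto simp: bij_betw_def comp_def)
  finally have "enumerates_atoms (?J, ?e) \<mu>"
    by (simp add: enumerates_atoms_def)
  then show ?thesis by blast
qed

section \<open>Removing points and superposition\<close>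

text \<open>Removing a Dirac mass at \<open>e j\<close> amounts to deleting the index
  \<open>j\<close>. Each set containing \<open>e j\<close> has \<open>j\<close> in its preimage, so
  the truncated subtraction never cuts anything off.\<close>

lemma remove_point_distr_count_space:
  fixes e :: "nat \<Rightarrow> 'a::t1_space"
  assumes j: "j \<in> J"
  shows "remove_point (e j) (distr (count_space J) borel e) = distr (count_space (J - {j})) borel e"
proof -
  let ?M = "distr (count_space J) borel e" and ?N = "distr (count_space (J - {j})) borel e"
  have "emeasure ?M A - emeasure (return borel (e j)) A = emeasure ?N A" if A: "A \<in> sets borel" for A
  proof -
    let ?X = "e -` A \<inter> (J - {j})"
    have M: "emeasure ?M A = emeasure (count_space J) (e -` A \<inter> J)"
      and N: "emeasure ?N A = emeasure (count_space (J - {j})) ?X"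
      using A by (simp_all add: emeasure_distr)
    have sub: "?X \<subseteq> J" by auto
    show ?thesis
    proof (cases "e j \<in> A")
      case True
      then have eq: "e -` A \<inter> J = insert j ?X" using j by auto
      show ?thesis
        \<comment> \<open>If the preimage is infinite, both sides are infinite; the subtraction of 1
          is visible only in the finite case.\<close>
        unfolding M N eq using j A True sub
        by (cases "finite ?X") (simp_all add: emeasure_count_space)
    next
      case False
      then have eq: "e -` A \<inter> J = ?X" by auto
      show ?thesis
        unfolding M N eq using A False sub
        by (cases "finite ?X") (simp_all add: emeasure_count_space)
    qed
  qed
  \<comment> \<open>\<open>diff_measure\<close> is built from a set function, which only has to be
    compared with that of \<open>?N\<close> on Borel sets; as the latter is a measure, the
    construction does not fall back on its default.\<close>
  then have "diff_measure ?M (return borel (e j)) = measure_of UNIV (sets borel) (emeasure ?N)"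
    unfolding diff_measure_def using sets.sigma_sets_eq[of "borel :: 'a measure"]
    by (simp, intro measure_of_eq) auto
  also have "\<dots> = ?N"
    using measure_of_of_measure[of ?N] by simp
  finally show ?thesis by (simp add: remove_point_def)
qed

lemma remove_point_atom:
  fixes \<mu> :: "'a::polish_space measure"
  assumes \<mu>: "\<mu> \<in> counting_measures" and x: "emeasure \<mu> {x} \<noteq> 0"
  shows "\<exists>J e j. \<mu> = distr (count_space J) borel e \<and> j \<in> J \<and> e j = x
    \<and> remove_point x \<mu> = distr (count_space (J - {j})) borel (e :: nat \<Rightarrow> 'a)"
proof -
  obtain J e where e: "\<mu> = distr (count_space J) borel (e :: nat \<Rightarrow> 'a)"
    using ex_enumerates_atoms[OF \<mu>] by (auto simp: enumerates_atoms_def)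
  have "e -` {x} \<inter> J \<noteq> {}"
    using x unfolding e by (auto simp: emeasure_distr)
  then obtain j where "j \<in> J" "e j = x" by auto
  with e show ?thesis using remove_point_distr_count_space[of j J e] by blast
qed

lemma sigma_sets_borel: "sigma_sets UNIV (sets borel) = sets borel"
  by (metis sets.sigma_sets_eq space_borel)

lemma sets_remove_point [simp]:
  "sets \<mu> = sets borel \<Longrightarrow> sets (remove_point x \<mu>) = sets borel"
  unfolding remove_point_def diff_measure_def
  by (metis sets.sigma_sets_eq sets.space_closed sets_measure_of)

text \<open>Adding the removed mass back instead of subtracting it keeps the identity valid for sets
  of infinite mass and free of truncation.\<close>

lemma emeasure_remove_point_add:
  fixes \<mu> :: "'a::polish_space measure"
  assumes \<mu>: "\<mu> \<in> counting_measures" and x: "emeasure \<mu> {x} \<noteq> 0" and A: "A \<in> sets borel"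
  shows "emeasure (remove_point x \<mu>) A + indicator A x = emeasure \<mu> A"
proof -
  obtain J e j where e: "\<mu> = distr (count_space J) borel (e :: nat \<Rightarrow> 'a)" "j \<in> J" "e j = x"
    and rem: "remove_point x \<mu> = distr (count_space (J - {j})) borel e"
    using remove_point_atom[OF \<mu> x] by blast
  let ?X = "e -` A \<inter> (J - {j})"
  have M: "emeasure \<mu> A = emeasure (count_space J) (e -` A \<inter> J)"
    using A by (simp add: emeasure_distr e)
  have N: "emeasure (remove_point x \<mu>) A = emeasure (count_space (J - {j})) ?X"
    unfolding rem using A by (simp add: emeasure_distr)
  have sub: "?X \<subseteq> J" by auto
  have eq: "e -` A \<inter> J = (if x \<in> A then insert j ?X else ?X)" using e by auto
  show ?thesis
    unfolding M N eq using e(2) sub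
    by (cases "finite ?X") (simp_all add: emeasure_count_space)
qed

text \<open>Without an atom at \<open>x\<close> the truncated difference is not additive, so the measure is the junk value \<open>0\<close>;
  this makes \<^const>\<open>remove_point\<close> measurable on the whole space.\<close>

lemma remove_point_non_atom:
  fixes \<mu> :: "'a::polish_space measure"
  assumes \<mu>: "\<mu> \<in> counting_measures" and x: "emeasure \<mu> {x} = 0"
  shows "remove_point x \<mu> = null_measure borel"
proof (rule measure_eqI)
  note [simp] = counting_measuresD(1,2)[OF \<mu>]
  show "sets (remove_point x \<mu>) = sets (null_measure borel)" by simp
  fix A assume A: "A \<in> sets (remove_point x \<mu>)"
  let ?f = "\<lambda>A. emeasure \<mu> A - emeasure (return borel x) A"
  \<comment> \<open>The construction of a measure from a set function returns 0 throughout when the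
    set function is not a measure.\<close>
  have conv: "emeasure (remove_point x \<mu>) B
      = (if B \<in> sets borel \<and> measure_space UNIV (sets borel) ?f then ?f B else 0)" for B
    by (simp add: remove_point_def diff_measure_def emeasure_measure_of_conv
        sigma_sets_borel)
  show "emeasure (remove_point x \<mu>) A = emeasure (null_measure borel) A"
  proof (cases "measure_space UNIV (sets borel) ?f \<and> emeasure \<mu> UNIV \<noteq> 0")
    case True
    have ex: "\<exists>y. emeasure \<mu> {y} \<noteq> 0"
    proof (rule ccontr)
      assume "\<not> ?thesis"
      then have "AE x in \<mu>. False" using AE_atom[OF \<mu>] by simp
      then have "emeasure \<mu> (space \<mu>) = 0" by (simp add: AE_iff_measurable[OF _ refl])
      with True show False by simp
    qed
    then obtain y where y: "emeasure \<mu> {y} \<noteq> 0" by blast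
    with x have xy: "x \<noteq> y" by auto
    have f: "emeasure (remove_point x \<mu>) B = ?f B" if "B \<in> sets borel" for B
      using that True by (simp add: conv)
    \<comment> \<open>Truncation gives \<open>{x}\<close> the value 0 - 1 = 0 and leaves
      \<open>{y}\<close> untouched, but takes 1 away from \<open>{x, y}\<close>. Additivity would
      therefore force mass minus 1 to equal mass for a finite positive mass.\<close>
    have "emeasure (remove_point x \<mu>) {x, y} = emeasure (remove_point x \<mu>) {x} + emeasure (remove_point x \<mu>) {y}"
      using xy by (subst plus_emeasure) (auto simp: insert_commute)
    moreover have "emeasure \<mu> {x, y} = emeasure \<mu> {y}"
      using xy x plus_emeasure[of "{x}" \<mu> "{y}"] by (simp add: insert_commute)
    ultimately have "emeasure \<mu> {y} - 1 = emeasure \<mu> {y}"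
      using xy x by (simp add: f)
    moreover obtain r where "emeasure \<mu> {y} = ennreal r" "r > 0"
      using y counting_measure_singleton(1)[OF \<mu>, of y]
      by (cases "emeasure \<mu> {y}") (auto simp: less_le)
    ultimately have "ennreal (r - 1) = ennreal r" "r > 0"
      by (simp_all add: ennreal_minus flip: ennreal_1)
    then have False
      by (cases "r \<ge> 1") (simp_all add: ennreal_neg)
    then show ?thesis ..
  next
    case False
    \<comment> \<open>Either the default value 0 applies, or \<open>\<mu>\<close> is the zero
      measure and the difference vanishes as well.\<close>
    have "emeasure \<mu> A \<le> emeasure \<mu> UNIV" using A by (intro emeasure_mono) auto
    with False show ?thesis by (auto simp: conv)
  qed
qed

text \<open>Off the atoms the result is the zero measure. At an atom it counts the indices left in
  an enumeration, so its finite values are cardinalities; finiteness is inherited from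
  \<open>\<mu>\<close>, which dominates it.\<close>

lemma remove_point_counting_measures:
  fixes \<mu> :: "'a::polish_space measure"
  assumes \<mu>: "\<mu> \<in> counting_measures"
  shows "remove_point x \<mu> \<in> counting_measures"
proof (cases "emeasure \<mu> {x} = 0")
  case True
  show ?thesis
    unfolding remove_point_non_atom[OF \<mu> True] by (auto simp: counting_measures_def)
next
  case False
  note [simp] = counting_measuresD(1,2)[OF \<mu>]
  note add = emeasure_remove_point_add[OF \<mu> False]
  have le: "emeasure (remove_point x \<mu>) A \<le> emeasure \<mu> A" if "A \<in> sets borel" for A
    using add[OF that] by (metis le_iff_add)
  obtain J e j where
    rem: "remove_point x \<mu> = distr (count_space (J - {j})) borel (e :: nat \<Rightarrow> 'a)"
    using remove_point_atom[OF \<mu> False] by blast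
  have nat: "emeasure (remove_point x \<mu>) A \<in> \<nat>"
    if A: "A \<in> sets borel" and fin: "emeasure \<mu> A < \<infinity>" for A
  proof -
    have "emeasure (remove_point x \<mu>) A < \<infinity>"
      using le[OF A] fin by (rule le_less_trans)
    moreover have "emeasure (remove_point x \<mu>) A = emeasure (count_space (J - {j})) (e -` A \<inter> (J - {j}))"
      unfolding rem using A by (simp add: emeasure_distr)
    ultimately show ?thesis
      by (cases "finite (e -` A \<inter> (J - {j}))") auto
  qed
  show ?thesis
    unfolding counting_measures_def
  proof (intro CollectI conjI allI ballI impI)
    fix y
    obtain U where U: "open U" "y \<in> U" "emeasure \<mu> U < \<infinity>"
      using counting_measuresD(3)[OF \<mu>] by blast
    then have "emeasure (remove_point x \<mu>) U < \<infinity>"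
      using le[of U] by (auto intro: le_less_trans)
    with U show "\<exists>U. open U \<and> y \<in> U \<and> emeasure (remove_point x \<mu>) U < \<infinity>" by blast
  next
    fix B :: "'a set" assume B: "B \<in> sets borel" "compact (closure B)"
    have "emeasure \<mu> B \<in> \<nat>" using counting_measuresD(4)[OF \<mu> B] .
    then have "emeasure \<mu> B < \<infinity>" by (auto elim!: Nats_cases simp: of_nat_less_top)
    with B show "emeasure (remove_point x \<mu>) B \<in> \<nat>" by (intro nat)
  qed simp
qed

section \<open>Superposition of two counting measures\<close>

lemma add_measure_counting_measures:
  assumes \<mu>: "\<mu> \<in> counting_measures" and \<nu>: "\<nu> \<in> counting_measures"
  shows "\<mu> \<oplus>\<^sub>M \<nu> \<in> counting_measures"
proof -
  note [simp] = counting_measuresD(1,2)[OF \<mu>] counting_measuresD(1,2)[OF \<nu>]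
  show ?thesis
    unfolding counting_measures_def
  proof (intro CollectI conjI allI ballI impI)
    fix y
    obtain U V where U: "open U" "y \<in> U" "emeasure \<mu> U < \<infinity>" and V: "open V" "y \<in> V" "emeasure \<nu> V < \<infinity>"
      using counting_measuresD(3)[OF \<mu>] counting_measuresD(3)[OF \<nu>] by metis
    have "emeasure \<mu> (U \<inter> V) \<le> emeasure \<mu> U" "emeasure \<nu> (U \<inter> V) \<le> emeasure \<nu> V"
      using U V by (auto intro!: emeasure_mono)
    with U V have "emeasure (\<mu> \<oplus>\<^sub>M \<nu>) (U \<inter> V) < \<infinity>"
      by (auto simp: emeasure_add_measure intro: le_less_trans)
    with U V show "\<exists>U. open U \<and> y \<in> U \<and> emeasure (\<mu> \<oplus>\<^sub>M \<nu>) U < \<infinity>"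
      by (intro exI[of _ "U \<inter> V"]) auto
  next
    fix B :: "'a set" assume "B \<in> sets borel" "compact (closure B)"
    then show "emeasure (\<mu> \<oplus>\<^sub>M \<nu>) B \<in> \<nat>"
      using counting_measuresD(4)[OF \<mu>] counting_measuresD(4)[OF \<nu>] by (simp add: emeasure_add_measure)
  qed simp
qed

lemma measurable_add_measure [measurable]:
  assumes f[measurable]: "f \<in> N \<rightarrow>\<^sub>M CM" and g[measurable]: "g \<in> N \<rightarrow>\<^sub>M CM"
  shows "(\<lambda>w. f w \<oplus>\<^sub>M g w) \<in> N \<rightarrow>\<^sub>M CM"
proof (rule measurable_into_CM)
  note fg = measurable_space[OF f, THEN counting_measures_if_space_CM] measurable_space[OF g, THEN counting_measures_if_space_CM]
  show "f w \<oplus>\<^sub>M g w \<in> counting_measures" if "w \<in> space N" for w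
    using fg[OF that] by (rule add_measure_counting_measures)
  fix B :: "'b set" assume B[measurable]: "B \<in> sets borel"
  have "(\<lambda>w. emeasure (f w) B + emeasure (g w) B) \<in> borel_measurable N" by measurable
  then show "(\<lambda>w. emeasure (f w \<oplus>\<^sub>M g w) B) \<in> borel_measurable N"
    using fg B by (subst measurable_cong) (auto simp: emeasure_add_measure counting_measuresD(1))
qed

lemma nn_integral_add_measure:
  assumes sets: "sets M = sets N" and f: "f \<in> borel_measurable M"
  shows "integral\<^sup>N (M \<oplus>\<^sub>M N) f = integral\<^sup>N M f + integral\<^sup>N N f"
proof -
  have meas: "g \<in> borel_measurable N" "g \<in> borel_measurable (M \<oplus>\<^sub>M N)"
    if "g \<in> borel_measurable M" for g :: "'a \<Rightarrow> ennreal"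
    using that measurable_cong_sets[OF sets refl, of borel]
      measurable_cong_sets[OF sets_add_measure refl, of M N borel] by auto
  show ?thesis
    using f
  proof (induction rule: borel_measurable_induct)
    case (cong f g)
    have "integral\<^sup>N L f = integral\<^sup>N L g" if "space L = space M" for L
      using cong(3) that by (intro nn_integral_cong) auto
    then show ?case
      using cong(4) sets_eq_imp_space_eq[OF sets] by simp
  next
    case (set A)
    then show ?case using sets by (simp add: emeasure_add_measure)
  next
    case (mult u c)
    then have u: "u \<in> borel_measurable M" by simp
    show ?case
      unfolding nn_integral_cmult[OF u] nn_integral_cmult[OF meas(1)[OF u]] nn_integral_cmult[OF meas(2)[OF u]]
      using mult by (simp add: distrib_left)
  next
    case (add u v)
    then have u: "v \<in> borel_measurable M" "u \<in> borel_measurable M" by simp_all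
    show ?case
      unfolding nn_integral_add[OF u] nn_integral_add[OF u[THEN meas(1)]] nn_integral_add[OF u[THEN meas(2)]]
      using add by (simp add: ac_simps)
  next
    case (seq U)
    have mono: "incseq (\<lambda>i. integral\<^sup>N L (U i))" for L :: "'a measure"
      by (rule incseq_SucI, rule nn_integral_mono) (metis \<open>incseq U\<close> incseq_SucD le_funE)
    have eq: "integral\<^sup>N L (\<lambda>x. SUP i. U i x) = (SUP i. integral\<^sup>N L (U i))"
      if "\<And>i. U i \<in> borel_measurable L" for L :: "'a measure"
      using \<open>incseq U\<close> that by (rule nn_integral_monotone_convergence_SUP)
    have U: "U i \<in> borel_measurable M" for i using seq by simp
    show ?case
      unfolding Sup_apply image_image eq[OF U] eq[OF meas(1)[OF U]] eq[OF meas(2)[OF U]]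
      using seq by (simp add: ennreal_SUP_add mono)
  qed
qed

section \<open>Measurability of integrals against counting measures\<close>

text \<open>Measurability of parameter integrals is available for subprobability kernels, whereas
  \<open>k w\<close> may be infinite. On a set \<open>V\<close> of finite mass \<open>k w\<close> is
  normalised to a subprobability kernel, and multiplication by the mass of \<open>V\<close> restores
  the integral over \<open>V\<close>. The members of the family are not nested, but each term is at
  most the full integral, and an exhaustion depending on \<open>w\<close> inside the family shows
  that the supremum reaches it.\<close>

lemma nn_integral_measurable_CM:
  fixes k :: "'w \<Rightarrow> 'a::polish_space measure"
  assumes k[measurable]: "k \<in> N \<rightarrow>\<^sub>M CM"
    and f[measurable]: "(\<lambda>(w, y). f w y) \<in> borel_measurable (N \<Otimes>\<^sub>M borel)"
  shows "(\<lambda>w. \<integral>\<^sup>+y. f w y \<partial>k w) \<in> borel_measurable N"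
proof -
  obtain \<V> :: "'a set set" where \<V>: "countable \<V>" "sets borel = sigma_sets UNIV \<V>" and
    exh: "\<And>\<mu>. \<mu> \<in> counting_measures \<Longrightarrow>
       \<exists>W::nat \<Rightarrow> 'a set. range W \<subseteq> \<V> \<and> incseq W \<and> (\<Union>n. W n) = UNIV \<and> (\<forall>n. emeasure \<mu> (W n) < \<infinity>)"
    by (rule countable_exhausting_family) blast
  have Vb: "V \<in> sets borel" if "V \<in> \<V>" for V using that \<V>(2) by auto
  note kD = counting_measuresD[OF counting_measures_if_space_CM[OF measurable_space[OF k]]]
  \<comment> \<open>Where \<open>V\<close> has infinite mass the kernel is set to 0; infinity times
    0 being 0, the term for this \<open>V\<close> contributes nothing to the supremum.\<close>
  define \<kappa> where "\<kappa> V w = (if emeasure (k w) V < \<infinity> then uniform_measure (k w) V else null_measure borel)" for V w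
  have \<kappa>: "\<kappa> V \<in> N \<rightarrow>\<^sub>M subprob_algebra borel" if V: "V \<in> \<V>" for V
  proof (rule measurable_subprob_algebra)
    note Vb[OF V, measurable]
    fix w assume w: "w \<in> space N"
    note [simp] = kD(1,2)[OF w]
    show "sets (\<kappa> V w) = sets borel" by (simp add: \<kappa>_def)
    show "subprob_space (\<kappa> V w)"
    proof (rule subprob_spaceI)
      show "emeasure (\<kappa> V w) (space (\<kappa> V w)) \<le> 1"
      \<comment> \<open>For a null set \<open>V\<close> the quotient 0/0 is 0, so the normalised
        measure has total mass 0 and not 1.\<close>
      proof (cases "emeasure (k w) V = 0 \<or> emeasure (k w) V = \<infinity>")
        case True
        then show ?thesis using Vb[OF V] by (auto simp: \<kappa>_def)
      next
        case False
        then show ?thesis using Vb[OF V] by (auto simp: \<kappa>_def ennreal_divide_self less_top)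
      qed
      show "space (\<kappa> V w) \<noteq> {}" by (simp add: \<kappa>_def)
    qed
  next
    note Vb[OF V, measurable]
    fix A :: "'a set" assume A[measurable]: "A \<in> sets borel"
    have "(\<lambda>w. if emeasure (k w) V < \<infinity> then emeasure (k w) (V \<inter> A) / emeasure (k w) V else 0) \<in> borel_measurable N"
      by measurable
    also have "?this \<longleftrightarrow> (\<lambda>w. emeasure (\<kappa> V w) A) \<in> borel_measurable N"
      using A Vb[OF V] by (intro measurable_cong) (simp add: \<kappa>_def kD)
    finally show "(\<lambda>w. emeasure (\<kappa> V w) A) \<in> borel_measurable N" .
  qed
  let ?t = "\<lambda>V w. emeasure (k w) V * (\<integral>\<^sup>+y. f w y \<partial>\<kappa> V w)"
  have fw: "f w \<in> borel_measurable borel" if "w \<in> space N" for w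
    using measurable_Pair2[OF f that] unfolding prod.case .
  have "(\<integral>\<^sup>+y. f w y \<partial>k w) = (SUP V\<in>\<V>. ?t V w)" if w: "w \<in> space N" for w
  proof -
    note [simp] = kD(1,2)[OF w]
    have fk[measurable]: "f w \<in> borel_measurable (k w)"
      using fw[OF w] by (simp cong: measurable_cong_sets)
    have t: "?t V w = (if emeasure (k w) V < \<infinity> then \<integral>\<^sup>+y. f w y * indicator V y \<partial>k w else 0)"
      if V: "V \<in> \<V>" for V
    \<comment> \<open>Normalisation can be undone only for positive mass; for a null set both sides
      are 0.\<close>
    proof (cases "emeasure (k w) V = 0")
      case True
      have "AE y in k w. y \<notin> V" using True Vb[OF V] by (intro AE_not_in) auto
      then have "(\<integral>\<^sup>+y. f w y * indicator V y \<partial>k w) = (\<integral>\<^sup>+y. 0 \<partial>k w)"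
        by (intro nn_integral_cong_AE) auto
      with True show ?thesis by simp
    next
      case False
      have c: "c * (x / c) = x" if "c \<noteq> 0" "c < \<infinity>" for c x :: ennreal
        using that by (simp add: ennreal_times_divide ennreal_mult_divide_eq mult.commute[of c])
      from False show ?thesis
        using Vb[OF V] by (auto simp: \<kappa>_def nn_integral_uniform_measure c[simplified] nn_integral_null_measure)
    qed
    obtain W :: "nat \<Rightarrow> 'a set" where
      W: "range W \<subseteq> \<V>" "incseq W" "(\<Union>n. W n) = UNIV" "\<And>n. emeasure (k w) (W n) < \<infinity>"
      using exh[OF counting_measures_if_space_CM[OF measurable_space[OF k w]]] by metis
    have Wb: "W n \<in> sets borel" for n using W(1) Vb by auto
    then have [measurable]: "W n \<in> sets (k w)" for n by simp
    have tW: "?t (W n) w = (\<integral>\<^sup>+y. f w y * indicator (W n) y \<partial>k w)" for n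
      using t[of "W n"] W(1,4) by auto
    show ?thesis
    proof (rule antisym)
      have "(\<integral>\<^sup>+y. f w y \<partial>k w) = (\<integral>\<^sup>+y. (SUP n. f w y * indicator (W n) y) \<partial>k w)"
      proof (intro nn_integral_cong)
        fix y
        obtain n where "y \<in> W n" using W(3) by auto
        then show "f w y = (SUP n. f w y * indicator (W n) y)"
          by (intro antisym SUP_upper2[of n] SUP_least) (auto split: split_indicator)
      qed
      also have "\<dots> = (SUP n. \<integral>\<^sup>+y. f w y * indicator (W n) y \<partial>k w)"
        using W(2) by (intro nn_integral_monotone_convergence_SUP)
          (auto simp: incseq_def le_fun_def split: split_indicator)
      also have "\<dots> = (SUP n. ?t (W n) w)"
        by (simp only: tW)
      also have "\<dots> \<le> (SUP V\<in>\<V>. ?t V w)"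
        by (rule SUP_mono) (use W(1) in blast)
      finally show "(\<integral>\<^sup>+y. f w y \<partial>k w) \<le> (SUP V\<in>\<V>. ?t V w)" .
      show "(SUP V\<in>\<V>. ?t V w) \<le> (\<integral>\<^sup>+y. f w y \<partial>k w)"
        by (rule SUP_least) (auto simp: t intro!: nn_integral_mono split: split_indicator)
    qed
  qed
  moreover have "(\<lambda>w. SUP V\<in>\<V>. ?t V w) \<in> borel_measurable N"
  proof (rule borel_measurable_SUP[OF \<V>(1)])
    fix V assume V: "V \<in> \<V>"
    note Vb[OF V, measurable]
    have [measurable]: "(\<lambda>w. \<integral>\<^sup>+y. f w y \<partial>\<kappa> V w) \<in> borel_measurable N"
      using f \<kappa>[OF V] by (rule nn_integral_measurable_subprob_algebra2)
    show "?t V \<in> borel_measurable N" by measurable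
  qed
  ultimately show ?thesis
    by (simp only: cong: measurable_cong)
qed

text \<open>The singleton moves with \<open>w\<close>, so measurability of the mass of a fixed Borel
  set does not apply. The diagonal is measurable in the product, and its section is integrated
  against \<open>k w\<close>.\<close>

lemma measurable_emeasure_singleton [measurable (raw)]:
  fixes k :: "'w \<Rightarrow> 'a::polish_space measure"
  assumes k[measurable]: "k \<in> N \<rightarrow>\<^sub>M CM" and h[measurable]: "h \<in> N \<rightarrow>\<^sub>M borel"
  shows "(\<lambda>w. emeasure (k w) {h w}) \<in> borel_measurable N"
proof -
  have "(\<lambda>w. \<integral>\<^sup>+y. (if h w = y then 1 else 0) \<partial>k w) \<in> borel_measurable N"
    by (rule nn_integral_measurable_CM) measurable
  also have "?this \<longleftrightarrow> ?thesis"
  proof (rule measurable_cong)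
    fix w assume w: "w \<in> space N"
    note kD = counting_measuresD[OF counting_measures_if_space_CM[OF measurable_space[OF k w]]]
    have "(\<integral>\<^sup>+y. (if h w = y then 1 else 0) \<partial>k w) = (\<integral>\<^sup>+y. indicator {h w} y \<partial>k w)"
      by (intro nn_integral_cong) (auto split: split_indicator)
    also have "\<dots> = emeasure (k w) {h w}" using kD(1) by (subst nn_integral_indicator) auto
    finally show "(\<integral>\<^sup>+y. (if h w = y then 1 else 0) \<partial>k w) = emeasure (k w) {h w}" .
  qed
  finally show ?thesis .
qed

lemma measurable_remove_point [measurable (raw)]:
  fixes k :: "'w \<Rightarrow> 'a::polish_space measure"
  assumes h[measurable]: "h \<in> N \<rightarrow>\<^sub>M borel" and k[measurable]: "k \<in> N \<rightarrow>\<^sub>M CM"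
  shows "(\<lambda>w. remove_point (h w) (k w)) \<in> N \<rightarrow>\<^sub>M CM"
proof (rule measurable_into_CM)
  note kD = counting_measures_if_space_CM[OF measurable_space[OF k]]
  show "remove_point (h w) (k w) \<in> counting_measures" if "w \<in> space N" for w
    using kD[OF that] by (rule remove_point_counting_measures)
  fix B :: "'a set" assume B[measurable]: "B \<in> sets borel"
  \<comment> \<open>Off the atoms the zero measure is taken; at an atom the difference is exact
    because the indicator is finite. The case distinction is measurable by the mass of the moving
    singleton.\<close>
  have "(\<lambda>w. if emeasure (k w) {h w} = 0 then 0 else emeasure (k w) B - indicator B (h w)) \<in> borel_measurable N"
    by measurable
  also have "?this \<longleftrightarrow> (\<lambda>w. emeasure (remove_point (h w) (k w)) B) \<in> borel_measurable N"
  proof (rule measurable_cong)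
    fix w assume w: "w \<in> space N"
    show "(if emeasure (k w) {h w} = 0 then 0 else emeasure (k w) B - indicator B (h w))
        = emeasure (remove_point (h w) (k w)) B"
    proof (cases "emeasure (k w) {h w} = 0")
      case True
      then show ?thesis using remove_point_non_atom[OF kD[OF w]] by simp
    next
      case False
      show ?thesis
        unfolding emeasure_remove_point_add[OF kD[OF w] False B, symmetric]
        using False by (simp split: split_indicator)
    qed
  qed
  finally show "(\<lambda>w. emeasure (remove_point (h w) (k w)) B) \<in> borel_measurable N" .
qed

text \<open>For a fixed index \<open>j\<close> the sum over the indices different from
  \<open>j\<close> is the integral against the measure with one copy of the atom \<open>e j\<close>
  deleted. The right-hand side contains no enumeration, hence the one chosen by \<open>SOME\<close>
  has no influence.\<close>

lemma nn_integral_second_factorial_measure: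
  fixes \<mu> :: "'a::polish_space measure"
  assumes \<mu>: "\<mu> \<in> counting_measures" and g[measurable]: "g \<in> borel_measurable (borel \<Otimes>\<^sub>M borel)"
  shows "(\<integral>\<^sup>+z. g z \<partial>second_factorial_measure \<mu>) = (\<integral>\<^sup>+x. \<integral>\<^sup>+y. g (x, y) \<partial>remove_point x \<mu> \<partial>\<mu>)"
proof -
  obtain J e where sel: "(SOME e. enumerates_atoms e \<mu>) = (J, e)"
    by (cases "SOME e. enumerates_atoms e \<mu>")
  then have e: "\<mu> = distr (count_space J) borel e"
    using someI_ex[OF ex_enumerates_atoms[OF \<mu>]] by (simp add: enumerates_atoms_def)
  let ?J = "{(j, m). j \<in> J \<and> m \<in> J \<and> j \<noteq> m}"
  have [measurable]: "g \<in> borel_measurable borel" using g by (simp add: borel_prod)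
  have "\<mu> \<in> space CM" using \<mu> by (simp add: space_counting_measure_algebra)
  then have [measurable]: "(\<lambda>_. \<mu>) \<in> borel \<rightarrow>\<^sub>M CM" by simp
  have inner[measurable]: "(\<lambda>x. \<integral>\<^sup>+y. g (x, y) \<partial>remove_point x \<mu>) \<in> borel_measurable borel"
    by (rule nn_integral_measurable_CM) measurable
  have "(\<integral>\<^sup>+z. g z \<partial>second_factorial_measure \<mu>) = (\<integral>\<^sup>+p. g (e (fst p), e (snd p)) \<partial>count_space ?J)"
    by (simp add: second_factorial_measure_def sel nn_integral_distr case_prod_beta')
  also have "\<dots> = (\<integral>\<^sup>+p. g (e (fst p), e (snd p)) * indicator ?J p \<partial>count_space UNIV)"
    by (subst nn_integral_count_space_indicator) auto
  also have "\<dots> = (\<integral>\<^sup>+j. \<integral>\<^sup>+m. g (e j, e m) * indicator ?J (j, m) \<partial>count_space UNIV \<partial>count_space UNIV)"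
    by (subst nn_integral_fst_count_space[symmetric]) simp
  also have "\<dots> = (\<integral>\<^sup>+j. (\<integral>\<^sup>+m. g (e j, e m) \<partial>count_space (J - {j})) * indicator J j \<partial>count_space UNIV)"
  proof (intro nn_integral_cong)
    fix j
    have "(\<integral>\<^sup>+m. g (e j, e m) * indicator ?J (j, m) \<partial>count_space UNIV)
        = (\<integral>\<^sup>+m. g (e j, e m) * indicator (J - {j}) m * indicator J j \<partial>count_space UNIV)"
      by (intro nn_integral_cong) (auto split: split_indicator)
    also have "\<dots> = (\<integral>\<^sup>+m. g (e j, e m) * indicator (J - {j}) m \<partial>count_space UNIV) * indicator J j"
      by (rule nn_integral_multc) simp
    finally show "(\<integral>\<^sup>+m. g (e j, e m) * indicator ?J (j, m) \<partial>count_space UNIV)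
        = (\<integral>\<^sup>+m. g (e j, e m) \<partial>count_space (J - {j})) * indicator J j"
      by (subst nn_integral_count_space_indicator[of "J - {j}"]) auto
  qed
  also have "\<dots> = (\<integral>\<^sup>+j. (\<integral>\<^sup>+m. g (e j, e m) \<partial>count_space (J - {j})) \<partial>count_space J)"
    by (subst nn_integral_count_space_indicator[of J]) auto
  also have "\<dots> = (\<integral>\<^sup>+j. (\<integral>\<^sup>+y. g (e j, y) \<partial>remove_point (e j) \<mu>) \<partial>count_space J)"
  proof (intro nn_integral_cong)
    fix j assume "j \<in> space (count_space J)"
    then have "remove_point (e j) \<mu> = distr (count_space (J - {j})) borel e"
      using remove_point_distr_count_space[of j J e] e by simp
    then show "(\<integral>\<^sup>+m. g (e j, e m) \<partial>count_space (J - {j})) = (\<integral>\<^sup>+y. g (e j, y) \<partial>remove_point (e j) \<mu>)"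
      by (simp add: nn_integral_distr)
  qed
  also have "\<dots> = (\<integral>\<^sup>+x. \<integral>\<^sup>+y. g (x, y) \<partial>remove_point x \<mu> \<partial>distr (count_space J) borel e)"
    by (subst nn_integral_distr) auto
  also have "\<dots> = (\<integral>\<^sup>+x. \<integral>\<^sup>+y. g (x, y) \<partial>remove_point x \<mu> \<partial>\<mu>)"
    by (simp add: e[symmetric])
  finally show ?thesis .
qed

section \<open>Disintegration\<close>

lemma measurable_fst_borel [measurable]: "fst \<in> (borel :: ('a::second_countable_topology \<times> 'b::second_countable_topology) measure) \<rightarrow>\<^sub>M borel"
  and measurable_snd_borel [measurable]: "snd \<in> (borel :: ('a \<times> 'b) measure) \<rightarrow>\<^sub>M borel"
  unfolding borel_prod[symmetric] by measurable

text \<open>The mean of a random measure, with no finiteness asked of the single measures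
  \<open>k w\<close>. Both kinds of moment measures have this form, and so do the joint measures of
  point and configuration that are compared in the disintegration.\<close>

definition kernel_mixture :: "'w measure \<Rightarrow> ('w \<Rightarrow> 'b measure) \<Rightarrow> 'b measure \<Rightarrow> 'b measure" where
  "kernel_mixture N k B = measure_of (space B) (sets B) (\<lambda>A. \<integral>\<^sup>+w. emeasure (k w) A \<partial>N)"

lemma sets_kernel_mixture [simp, measurable_cong]: "sets (kernel_mixture N k B) = sets B"
  and space_kernel_mixture [simp]: "space (kernel_mixture N k B) = space B"
  by (simp_all add: kernel_mixture_def)

lemma emeasure_kernel_mixture:
  assumes sets: "\<And>w. w \<in> space N \<Longrightarrow> sets (k w) = sets B"
    and meas: "\<And>A. A \<in> sets B \<Longrightarrow> (\<lambda>w. emeasure (k w) A) \<in> borel_measurable N"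
    and A: "A \<in> sets B"
  shows "emeasure (kernel_mixture N k B) A = (\<integral>\<^sup>+w. emeasure (k w) A \<partial>N)"
  unfolding kernel_mixture_def
proof (rule emeasure_measure_of_sigma)
  show "sigma_algebra (space B) (sets B)" ..
  show "positive (sets B) (\<lambda>A. \<integral>\<^sup>+w. emeasure (k w) A \<partial>N)"
    by (simp add: positive_def)
  show "countably_additive (sets B) (\<lambda>A. \<integral>\<^sup>+w. emeasure (k w) A \<partial>N)"
  proof (rule countably_additiveI)
    fix F :: "nat \<Rightarrow> 'b set" assume F: "range F \<subseteq> sets B" "disjoint_family F"
    have "(\<Sum>i. \<integral>\<^sup>+w. emeasure (k w) (F i) \<partial>N) = (\<integral>\<^sup>+w. (\<Sum>i. emeasure (k w) (F i)) \<partial>N)"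
      using F meas by (intro nn_integral_suminf[symmetric]) auto
    also have "\<dots> = (\<integral>\<^sup>+w. emeasure (k w) (\<Union>i. F i) \<partial>N)"
      using F sets by (intro nn_integral_cong suminf_emeasure) auto
    finally show "(\<Sum>i. \<integral>\<^sup>+w. emeasure (k w) (F i) \<partial>N) = (\<integral>\<^sup>+w. emeasure (k w) (\<Union>i. F i) \<partial>N)" .
  qed
qed fact

lemma nn_integral_kernel_mixture:
  assumes sets: "\<And>w. w \<in> space N \<Longrightarrow> sets (k w) = sets B"
    and meas: "\<And>f. f \<in> borel_measurable B \<Longrightarrow> (\<lambda>w. \<integral>\<^sup>+z. f z \<partial>k w) \<in> borel_measurable N"
    and f: "f \<in> borel_measurable B"
  shows "(\<integral>\<^sup>+z. f z \<partial>kernel_mixture N k B) = (\<integral>\<^sup>+w. \<integral>\<^sup>+z. f z \<partial>k w \<partial>N)"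
  using f
proof (induction rule: borel_measurable_induct)
  case (cong f g)
  have "(\<integral>\<^sup>+z. f z \<partial>L) = (\<integral>\<^sup>+z. g z \<partial>L)" if "space L = space B" for L
    using cong(3) that by (intro nn_integral_cong) auto
  moreover have "space (k w) = space B" if "w \<in> space N" for w
    using sets[OF that] by (rule sets_eq_imp_space_eq)
  ultimately show ?case
    using cong(4) by (simp cong: nn_integral_cong)
next
  case (set A)
  have m: "(\<lambda>w. emeasure (k w) A) \<in> borel_measurable N" if A: "A \<in> sets B" for A
  proof -
    have "(\<lambda>w. \<integral>\<^sup>+z. indicator A z \<partial>k w) \<in> borel_measurable N" using A by (intro meas) auto
    also have "?this \<longleftrightarrow> ?thesis" using A sets by (intro measurable_cong) auto
    finally show ?thesis .
  qed
  show ?case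
    using set sets m by (simp add: emeasure_kernel_mixture cong: nn_integral_cong)
next
  case (mult u c)
  have m: "w \<in> space N \<Longrightarrow> u \<in> borel_measurable (k w)" for w
    using mult(2) sets[of w] by (simp cong: measurable_cong_sets)
  show ?case
    using mult m meas[OF mult(2)] by (simp add: nn_integral_cmult cong: nn_integral_cong)
next
  case (add u v)
  have m: "w \<in> space N \<Longrightarrow> u \<in> borel_measurable (k w)" "w \<in> space N \<Longrightarrow> v \<in> borel_measurable (k w)" for w
    using add sets[of w] by (simp_all cong: measurable_cong_sets)
  show ?case
    using add m meas[of u] meas[of v] by (simp add: nn_integral_add cong: nn_integral_cong)
next
  case (seq U)
  have U: "U i \<in> borel_measurable B" for i using seq by simp
  have m: "w \<in> space N \<Longrightarrow> U i \<in> borel_measurable (k w)" for w i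
    using U[of i] sets[of w] by (simp cong: measurable_cong_sets)
  have "(\<integral>\<^sup>+w. \<integral>\<^sup>+z. (SUP i. U i z) \<partial>k w \<partial>N) = (\<integral>\<^sup>+w. (SUP i. \<integral>\<^sup>+z. U i z \<partial>k w) \<partial>N)"
    using m \<open>incseq U\<close> by (intro nn_integral_cong nn_integral_monotone_convergence_SUP) auto
  also have "\<dots> = (SUP i. \<integral>\<^sup>+w. \<integral>\<^sup>+z. U i z \<partial>k w \<partial>N)"
    using meas[OF U] \<open>incseq U\<close>
    by (intro nn_integral_monotone_convergence_SUP) (auto simp: incseq_def le_fun_def intro!: nn_integral_mono)
  also have "\<dots> = (SUP i. \<integral>\<^sup>+z. U i z \<partial>kernel_mixture N k B)"
    using seq by simp
  also have "\<dots> = (\<integral>\<^sup>+z. (SUP i. U i z) \<partial>kernel_mixture N k B)"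
    using U \<open>incseq U\<close> by (intro nn_integral_monotone_convergence_SUP[symmetric]) auto
  finally show ?case by (simp add: image_comp)
qed

text \<open>The two sides are integrals over mixtures of kernels, which agree on rectangles by \<open>eq\<close>.\<close>

lemma disintegration_nn_integral:
  assumes sets: "\<And>w. w \<in> space P \<Longrightarrow> sets (k w) = sets Z"
    and h: "\<And>w. w \<in> space P \<Longrightarrow> h w \<in> Z \<rightarrow>\<^sub>M C"
    and meas: "\<And>f. f \<in> borel_measurable (Z \<Otimes>\<^sub>M C) \<Longrightarrow> (\<lambda>w. \<integral>\<^sup>+z. f (z, h w z) \<partial>k w) \<in> borel_measurable P"
    and M: "sets M = sets Z" "sigma_finite_measure M"
    and K[measurable]: "K \<in> Z \<rightarrow>\<^sub>M prob_algebra C"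
    and eq: "\<And>A L. A \<in> sets Z \<Longrightarrow> L \<in> sets C \<Longrightarrow>
      (\<integral>\<^sup>+w. \<integral>\<^sup>+z. indicator A z * indicator L (h w z) \<partial>k w \<partial>P) = (\<integral>\<^sup>+z\<in>A. emeasure (K z) L \<partial>M)"
    and f: "f \<in> borel_measurable (Z \<Otimes>\<^sub>M C)"
  shows "(\<integral>\<^sup>+w. \<integral>\<^sup>+z. f (z, h w z) \<partial>k w \<partial>P) = (\<integral>\<^sup>+z. \<integral>\<^sup>+m. f (z, m) \<partial>K z \<partial>M)"
proof -
  \<comment> \<open>\<open>?k\<close> attaches to each point \<open>z\<close> of the realisation
    \<open>w\<close> the configuration \<open>h w z\<close>; \<open>?K\<close> attaches a random
    configuration with law \<open>K z\<close>. Averaging turns both into measures on pairs of point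
    and configuration.\<close>
  let ?k = "\<lambda>w. distr (k w) (Z \<Otimes>\<^sub>M C) (\<lambda>z. (z, h w z))"
  let ?K = "\<lambda>z. distr (K z) (Z \<Otimes>\<^sub>M C) (Pair z)"
  let ?N1 = "kernel_mixture P ?k (Z \<Otimes>\<^sub>M C)" and ?N2 = "kernel_mixture M ?K (Z \<Otimes>\<^sub>M C)"
  note [measurable_cong] = M(1)
  have spM: "space M = space Z" using M(1) by (rule sets_eq_imp_space_eq)
  have spk: "space (k w) = space Z" if "w \<in> space P" for w
    using sets[OF that] by (rule sets_eq_imp_space_eq)
  have K': "K \<in> Z \<rightarrow>\<^sub>M subprob_algebra C" using K by (rule measurable_prob_algebraD)
  have Kz: "sets (K z) = sets C" "space (K z) = space C" "prob_space (K z)" if "z \<in> space Z" for z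
    using measurable_space[OF K that] sets_eq_imp_space_eq[of "K z" C]
    by (auto simp: space_prob_algebra)
  have km: "(\<lambda>z. (z, h w z)) \<in> k w \<rightarrow>\<^sub>M Z \<Otimes>\<^sub>M C" if "w \<in> space P" for w
    using h[OF that] sets[OF that] by (subst measurable_cong_sets[OF sets[OF that] refl]) measurable
  have Km: "Pair z \<in> K z \<rightarrow>\<^sub>M Z \<Otimes>\<^sub>M C" if "z \<in> space Z" for z
    using Kz(1)[OF that] that by (subst measurable_cong_sets[OF Kz(1)[OF that] refl]) measurable
  have k1: "(\<integral>\<^sup>+p. f p \<partial>?k w) = (\<integral>\<^sup>+z. f (z, h w z) \<partial>k w)"
    if "f \<in> borel_measurable (Z \<Otimes>\<^sub>M C)" "w \<in> space P" for f w
    using that km by (subst nn_integral_distr) auto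
  have k2: "(\<integral>\<^sup>+p. f p \<partial>?K z) = (\<integral>\<^sup>+m. f (z, m) \<partial>K z)"
    if "f \<in> borel_measurable (Z \<Otimes>\<^sub>M C)" "z \<in> space Z" for f z
    using that Km by (subst nn_integral_distr) auto
  have m1: "(\<lambda>w. \<integral>\<^sup>+p. f p \<partial>?k w) \<in> borel_measurable P" if "f \<in> borel_measurable (Z \<Otimes>\<^sub>M C)" for f
    using meas[OF that] k1[OF that] by (simp cong: measurable_cong)
  have m2: "(\<lambda>z. \<integral>\<^sup>+p. f p \<partial>?K z) \<in> borel_measurable M" if f[measurable]: "f \<in> borel_measurable (Z \<Otimes>\<^sub>M C)" for f
  proof -
    have "(\<lambda>z. \<integral>\<^sup>+m. f (z, m) \<partial>K z) \<in> borel_measurable Z"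
      by (rule nn_integral_measurable_subprob_algebra2[OF _ K']) measurable
    then have "(\<lambda>z. \<integral>\<^sup>+m. f (z, m) \<partial>K z) \<in> borel_measurable M" by measurable
    also have "?this \<longleftrightarrow> ?thesis" using k2[OF f] spM by (intro measurable_cong) simp
    finally show ?thesis .
  qed
  have n1: "(\<integral>\<^sup>+p. f p \<partial>?N1) = (\<integral>\<^sup>+w. \<integral>\<^sup>+z. f (z, h w z) \<partial>k w \<partial>P)"
    if "f \<in> borel_measurable (Z \<Otimes>\<^sub>M C)" for f
    using that m1 k1[OF that] by (subst nn_integral_kernel_mixture) (auto cong: nn_integral_cong)
  have n2: "(\<integral>\<^sup>+p. f p \<partial>?N2) = (\<integral>\<^sup>+z. \<integral>\<^sup>+m. f (z, m) \<partial>K z \<partial>M)"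
    if "f \<in> borel_measurable (Z \<Otimes>\<^sub>M C)" for f
    using that m2 k2[OF that] spM by (subst nn_integral_kernel_mixture) (auto intro!: nn_integral_cong)
  let ?E = "{A \<times> L | A L. A \<in> sets Z \<and> L \<in> sets C}"
  have e2: "emeasure ?N2 (A \<times> L) = (\<integral>\<^sup>+z\<in>A. emeasure (K z) L \<partial>M)"
    if [measurable]: "A \<in> sets Z" "L \<in> sets C" for A L
  proof -
    have "emeasure ?N2 (A \<times> L) = (\<integral>\<^sup>+p. indicator (A \<times> L) p \<partial>?N2)" by simp
    also have "\<dots> = (\<integral>\<^sup>+z. \<integral>\<^sup>+m. indicator (A \<times> L) (z, m) \<partial>K z \<partial>M)"
      by (rule n2) measurable
    also have "\<dots> = (\<integral>\<^sup>+z\<in>A. emeasure (K z) L \<partial>M)"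
    proof (rule nn_integral_cong)
      fix z assume "z \<in> space M"
      then have "L \<in> sets (K z)" using that Kz spM by simp
      moreover have "(\<integral>\<^sup>+m. indicator (A \<times> L) (z, m) \<partial>K z) = (\<integral>\<^sup>+m. indicator A z * indicator L m \<partial>K z)"
        by (intro nn_integral_cong) (auto split: split_indicator)
      ultimately show "(\<integral>\<^sup>+m. indicator (A \<times> L) (z, m) \<partial>K z) = emeasure (K z) L * indicator A z"
        by (simp add: nn_integral_cmult mult.commute)
    qed
    finally show ?thesis .
  qed
  \<comment> \<open>Finiteness has to be checked on one side only and is easier for
    \<open>?N2\<close>: every \<open>K z\<close> has total mass 1, so the rectangle over
    \<open>F i\<close> has the mass of \<open>F i\<close> under \<open>M\<close>.\<close>
  have "?N2 = ?N1"
  proof -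
    obtain F :: "nat \<Rightarrow> 'b set" where
      F: "range F \<subseteq> sets M" "(\<Union>i. F i) = space M" "\<And>i. emeasure M (F i) \<noteq> \<infinity>"
      using sigma_finite_measure.sigma_finite[OF M(2)] by metis
    show ?thesis
    proof (rule measure_eqI_generator_eq[where E="?E" and \<Omega>="space Z \<times> space C"])
      show "Int_stable ?E" by (rule Int_stable_pair_measure_generator)
      show "?E \<subseteq> Pow (space Z \<times> space C)" by (rule pair_measure_closed)
      show "range (\<lambda>i. F i \<times> space C) \<subseteq> ?E" using F(1) M(1) by blast
      show "(\<Union>i. F i \<times> space C) = space Z \<times> space C" using F(2) spM by auto
      fix i
      have Fi: "F i \<in> sets Z" using F(1) M(1) by auto
      have "emeasure ?N2 (F i \<times> space C) = (\<integral>\<^sup>+z\<in>F i. emeasure (K z) (space C) \<partial>M)"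
        using Fi by (rule e2) simp
      also have "\<dots> = (\<integral>\<^sup>+z. indicator (F i) z \<partial>M)"
      proof (rule nn_integral_cong)
        fix z assume "z \<in> space M"
        then show "emeasure (K z) (space C) * indicator (F i) z = indicator (F i) z"
          using prob_space.emeasure_space_1[OF Kz(3)[of z]] Kz(2)[of z] spM by simp
      qed
      also have "\<dots> = emeasure M (F i)" using Fi M(1) by simp
      finally show "emeasure ?N2 (F i \<times> space C) \<noteq> \<infinity>" using F(3)[of i] by simp
    next
      fix X assume "X \<in> ?E"
      then obtain A L where X: "X = A \<times> L" and AL[measurable]: "A \<in> sets Z" "L \<in> sets C" by auto
      have "emeasure ?N1 X = (\<integral>\<^sup>+p. indicator (A \<times> L) p \<partial>?N1)"
        unfolding X by simp
      also have "\<dots> = (\<integral>\<^sup>+w. \<integral>\<^sup>+z. indicator (A \<times> L) (z, h w z) \<partial>k w \<partial>P)"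
        by (rule n1) measurable
      also have "\<dots> = (\<integral>\<^sup>+w. \<integral>\<^sup>+z. indicator A z * indicator L (h w z) \<partial>k w \<partial>P)"
        by (intro nn_integral_cong) (auto split: split_indicator)
      also have "\<dots> = emeasure ?N2 X"
        unfolding X by (simp add: eq AL e2)
      finally show "emeasure ?N2 X = emeasure ?N1 X" ..
    qed (simp_all add: sets_pair_measure)
  qed
  then show ?thesis
    using n1[OF f] n2[OF f] by simp
qed

section \<open>Second factorial measure of a superposition\<close>

text \<open>Nothing is known about the dependence of the chosen enumeration on \<open>w\<close>. In
  the iterated form two measurable families of counting measures are integrated one after the other,
  \<open>remove_point x (k w)\<close> inside and \<open>k w\<close> outside.\<close>

lemma nn_integral_measurable_second_factorial:
  fixes k :: "'w \<Rightarrow> 'a::polish_space measure"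
  assumes k[measurable]: "k \<in> N \<rightarrow>\<^sub>M CM"
    and f[measurable]: "(\<lambda>(w, z). f w z) \<in> borel_measurable (N \<Otimes>\<^sub>M borel)"
  shows "(\<lambda>w. \<integral>\<^sup>+z. f w z \<partial>second_factorial_measure (k w)) \<in> borel_measurable N"
proof -
  have "(\<lambda>w. \<integral>\<^sup>+x. \<integral>\<^sup>+y. f w (x, y) \<partial>remove_point x (k w) \<partial>k w) \<in> borel_measurable N"
  proof (rule nn_integral_measurable_CM[OF k])
    have "(\<lambda>p. \<integral>\<^sup>+y. f (fst p) (snd p, y) \<partial>remove_point (snd p) (k (fst p))) \<in> borel_measurable (N \<Otimes>\<^sub>M borel)"
      by (rule nn_integral_measurable_CM) measurable
    then show "(\<lambda>(w, x). \<integral>\<^sup>+y. f w (x, y) \<partial>remove_point x (k w)) \<in> borel_measurable (N \<Otimes>\<^sub>M borel)"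
      by (simp add: case_prod_beta')
  qed
  also have "?this \<longleftrightarrow> ?thesis"
  proof (rule measurable_cong)
    fix w assume w: "w \<in> space N"
    have "f w \<in> borel_measurable (borel \<Otimes>\<^sub>M borel)"
      using measurable_Pair2[OF f w] unfolding prod.case borel_prod .
    then show "(\<integral>\<^sup>+x. \<integral>\<^sup>+y. f w (x, y) \<partial>remove_point x (k w) \<partial>k w) = (\<integral>\<^sup>+z. f w z \<partial>second_factorial_measure (k w))"
      using counting_measures_if_space_CM[OF measurable_space[OF k w]] by (subst nn_integral_second_factorial_measure) auto
  qed
  finally show ?thesis .
qed

lemma sets_second_factorial_measure [simp]: "sets (second_factorial_measure \<mu>) = sets borel"
  by (simp add: second_factorial_measure_def split: prod.split)

lemma moment_measure_eq: "moment_measure P \<Phi> = kernel_mixture P \<Phi> borel"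
  by (simp add: moment_measure_def kernel_mixture_def)

lemma second_factorial_moment_measure_eq:
  "second_factorial_moment_measure P \<Phi> = kernel_mixture P (\<lambda>\<omega>. second_factorial_measure (\<Phi> \<omega>)) borel"
  by (simp add: second_factorial_moment_measure_def kernel_mixture_def)

lemma sets_moment_measure [simp, measurable_cong]: "sets (moment_measure P \<Phi>) = sets borel"
  and sets_second_factorial_moment_measure [simp, measurable_cong]:
    "sets (second_factorial_moment_measure P \<Phi>) = sets borel"
  by (simp_all add: moment_measure_eq second_factorial_moment_measure_eq)

section \<open>Removal of points from a superposition\<close>

definition remove_pair :: "'a \<times> 'a \<Rightarrow> 'a::topological_space measure \<Rightarrow> 'a measure" where
  "remove_pair z \<mu> = remove_point (snd z) (remove_point (fst z) \<mu>)"

lemma measurable_remove_pair [measurable (raw)]: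
  fixes k :: "'w \<Rightarrow> 'a::polish_space measure"
  assumes [measurable]: "h \<in> N \<rightarrow>\<^sub>M borel" "k \<in> N \<rightarrow>\<^sub>M CM"
  shows "(\<lambda>w. remove_pair (h w) (k w)) \<in> N \<rightarrow>\<^sub>M CM"
  unfolding remove_pair_def by measurable

text \<open>With \<open>x\<close> an atom of \<open>\<mu>\<close>, adding back the mass at
  \<open>x\<close> yields \<open>\<mu> \<oplus>\<^sub>M \<nu>\<close> on both sides, and a finite
  amount can be cancelled. Whether \<open>\<nu>\<close> charges \<open>x\<close> as well does not
  matter.\<close>

lemma remove_point_add_measure:
  fixes \<mu> \<nu> :: "'a::polish_space measure"
  assumes \<mu>: "\<mu> \<in> counting_measures" and \<nu>: "\<nu> \<in> counting_measures" and x: "emeasure \<mu> {x} \<noteq> 0"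
  shows "remove_point x (\<mu> \<oplus>\<^sub>M \<nu>) = remove_point x \<mu> \<oplus>\<^sub>M \<nu>"
proof (rule measure_eqI)
  note [simp] = counting_measuresD(1,2)[OF \<mu>] counting_measuresD(1,2)[OF \<nu>]
  show "sets (remove_point x (\<mu> \<oplus>\<^sub>M \<nu>)) = sets (remove_point x \<mu> \<oplus>\<^sub>M \<nu>)" by simp
  fix A assume "A \<in> sets (remove_point x (\<mu> \<oplus>\<^sub>M \<nu>))"
  then have A: "A \<in> sets borel" by simp
  have "emeasure (\<mu> \<oplus>\<^sub>M \<nu>) {x} \<noteq> 0" using x by (simp add: emeasure_add_measure)
  then have "emeasure (remove_point x (\<mu> \<oplus>\<^sub>M \<nu>)) A + indicator A x = emeasure (\<mu> \<oplus>\<^sub>M \<nu>) A"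
    using add_measure_counting_measures[OF \<mu> \<nu>] A by (intro emeasure_remove_point_add)
  also have "\<dots> = emeasure (remove_point x \<mu>) A + indicator A x + emeasure \<nu> A"
    using A by (simp add: emeasure_add_measure emeasure_remove_point_add[OF \<mu> x])
  also have "\<dots> = emeasure (remove_point x \<mu> \<oplus>\<^sub>M \<nu>) A + indicator A x"
    using A by (simp add: emeasure_add_measure ac_simps)
  finally show "emeasure (remove_point x (\<mu> \<oplus>\<^sub>M \<nu>)) A = emeasure (remove_point x \<mu> \<oplus>\<^sub>M \<nu>) A"
    by (simp split: split_indicator_asm)
qed

lemma add_measure_commute:
  assumes "sets \<mu> = sets \<nu>" shows "\<mu> \<oplus>\<^sub>M \<nu> = \<nu> \<oplus>\<^sub>M \<mu>"
  using assms by (intro measure_eqI) (simp_all add: emeasure_add_measure add.commute)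

text \<open>A product rule for removal: almost every point of \<open>\<mu>\<close> is an atom of
  \<open>\<mu>\<close>, so under the integral against \<open>\<mu>\<close> the removal acts on
  \<open>\<mu>\<close> alone, even where the two measures share atoms, and likewise for
  \<open>\<nu>\<close>. The integrand is arbitrary in point and configuration so that the rule can
  be iterated.\<close>

lemma nn_integral_remove_point_add:
  fixes \<mu> \<nu> :: "'a::polish_space measure"
  assumes \<mu>: "\<mu> \<in> counting_measures" and \<nu>: "\<nu> \<in> counting_measures"
    and h[measurable]: "(\<lambda>(x, \<mu>). h x \<mu>) \<in> borel_measurable (borel \<Otimes>\<^sub>M CM)"
  shows "(\<integral>\<^sup>+x. h x (remove_point x (\<mu> \<oplus>\<^sub>M \<nu>)) \<partial>(\<mu> \<oplus>\<^sub>M \<nu>))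
    = (\<integral>\<^sup>+x. h x (remove_point x \<mu> \<oplus>\<^sub>M \<nu>) \<partial>\<mu>) + (\<integral>\<^sup>+x. h x (\<mu> \<oplus>\<^sub>M remove_point x \<nu>) \<partial>\<nu>)"
proof -
  note [simp] = counting_measuresD(1,2)[OF \<mu>] counting_measuresD(1,2)[OF \<nu>]
  note mem = add_measure_counting_measures[OF \<mu> \<nu>]
  have "(\<lambda>_. \<mu> \<oplus>\<^sub>M \<nu>) \<in> borel \<rightarrow>\<^sub>M CM"
    using mem by (simp add: space_counting_measure_algebra)
  note [measurable] = this
  have "(\<lambda>x. h x (remove_point x (\<mu> \<oplus>\<^sub>M \<nu>))) \<in> borel_measurable borel" by measurable
  then have "(\<lambda>x. h x (remove_point x (\<mu> \<oplus>\<^sub>M \<nu>))) \<in> borel_measurable \<mu>"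
    by (simp cong: measurable_cong_sets)
  then have "(\<integral>\<^sup>+x. h x (remove_point x (\<mu> \<oplus>\<^sub>M \<nu>)) \<partial>(\<mu> \<oplus>\<^sub>M \<nu>))
    = (\<integral>\<^sup>+x. h x (remove_point x (\<mu> \<oplus>\<^sub>M \<nu>)) \<partial>\<mu>) + (\<integral>\<^sup>+x. h x (remove_point x (\<mu> \<oplus>\<^sub>M \<nu>)) \<partial>\<nu>)"
    by (intro nn_integral_add_measure) auto
  also have "(\<integral>\<^sup>+x. h x (remove_point x (\<mu> \<oplus>\<^sub>M \<nu>)) \<partial>\<mu>) = (\<integral>\<^sup>+x. h x (remove_point x \<mu> \<oplus>\<^sub>M \<nu>) \<partial>\<mu>)"
    using AE_atom[OF \<mu>] by (intro nn_integral_cong_AE) (auto simp: remove_point_add_measure[OF \<mu> \<nu>])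
  also have "(\<integral>\<^sup>+x. h x (remove_point x (\<mu> \<oplus>\<^sub>M \<nu>)) \<partial>\<nu>) = (\<integral>\<^sup>+x. h x (\<mu> \<oplus>\<^sub>M remove_point x \<nu>) \<partial>\<nu>)"
  proof (rule nn_integral_cong_AE)
    have "remove_point x (\<mu> \<oplus>\<^sub>M \<nu>) = \<mu> \<oplus>\<^sub>M remove_point x \<nu>" if "emeasure \<nu> {x} \<noteq> 0" for x
    proof -
      have "remove_point x (\<mu> \<oplus>\<^sub>M \<nu>) = remove_point x (\<nu> \<oplus>\<^sub>M \<mu>)"
        by (subst add_measure_commute) auto
      also have "\<dots> = remove_point x \<nu> \<oplus>\<^sub>M \<mu>"
        by (rule remove_point_add_measure[OF \<nu> \<mu> that])
      also have "\<dots> = \<mu> \<oplus>\<^sub>M remove_point x \<nu>"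
        by (rule add_measure_commute) auto
      finally show ?thesis .
    qed
    then show "AE x in \<nu>. h x (remove_point x (\<mu> \<oplus>\<^sub>M \<nu>)) = h x (\<mu> \<oplus>\<^sub>M remove_point x \<nu>)"
      using AE_atom[OF \<nu>] by auto
  qed
  finally show ?thesis .
qed

lemma nn_integral_remove_pair:
  fixes \<mu> :: "'a::polish_space measure"
  assumes \<mu>: "\<mu> \<in> counting_measures"
    and g[measurable]: "(\<lambda>(z, \<mu>). g z \<mu>) \<in> borel_measurable (borel \<Otimes>\<^sub>M CM)"
  shows "(\<integral>\<^sup>+z. g z (remove_pair z \<mu>) \<partial>second_factorial_measure \<mu>)
    = (\<integral>\<^sup>+x. \<integral>\<^sup>+y. g (x, y) (remove_point y (remove_point x \<mu>)) \<partial>remove_point x \<mu> \<partial>\<mu>)"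
proof -
  have "(\<lambda>_. \<mu>) \<in> borel \<rightarrow>\<^sub>M CM"
    using \<mu> by (simp add: space_counting_measure_algebra)
  note [measurable] = this
  have "(\<lambda>z. g z (remove_pair z \<mu>)) \<in> borel_measurable borel" by measurable
  then show ?thesis
    by (subst nn_integral_second_factorial_measure[OF \<mu>]) (simp_all add: borel_prod remove_pair_def)
qed

text \<open>The product rule is applied to the outer integral over \<open>x\<close> and to the inner
  one over \<open>y\<close>, where the configuration is already
  \<open>remove_point x \<mu> \<oplus>\<^sub>M \<nu>\<close> or
  \<open>\<mu> \<oplus>\<^sub>M remove_point x \<nu>\<close>. The pairs with both points from one
  measure recombine to its second factorial measure.\<close>

lemma nn_integral_remove_pair_add:
  fixes \<mu> \<nu> :: "'a::polish_space measure"
  assumes \<mu>: "\<mu> \<in> counting_measures" and \<nu>: "\<nu> \<in> counting_measures"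
    and g[measurable]: "(\<lambda>(z, \<mu>). g z \<mu>) \<in> borel_measurable (borel \<Otimes>\<^sub>M CM)"
  shows "(\<integral>\<^sup>+z. g z (remove_pair z (\<mu> \<oplus>\<^sub>M \<nu>)) \<partial>second_factorial_measure (\<mu> \<oplus>\<^sub>M \<nu>))
    = (\<integral>\<^sup>+z. g z (remove_pair z \<mu> \<oplus>\<^sub>M \<nu>) \<partial>second_factorial_measure \<mu>)
    + (\<integral>\<^sup>+x. \<integral>\<^sup>+y. g (x, y) (remove_point x \<mu> \<oplus>\<^sub>M remove_point y \<nu>) \<partial>\<nu> \<partial>\<mu>)
    + (\<integral>\<^sup>+x. \<integral>\<^sup>+y. g (x, y) (remove_point y \<mu> \<oplus>\<^sub>M remove_point x \<nu>) \<partial>\<mu> \<partial>\<nu>)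
    + (\<integral>\<^sup>+z. g z (\<mu> \<oplus>\<^sub>M remove_pair z \<nu>) \<partial>second_factorial_measure \<nu>)"
proof -
  note [simp] = counting_measuresD(1,2)[OF \<mu>] counting_measuresD(1,2)[OF \<nu>]
  have c1: "(\<lambda>_. \<mu>) \<in> (N :: 'c measure) \<rightarrow>\<^sub>M CM" and c2: "(\<lambda>_. \<nu>) \<in> (N :: 'c measure) \<rightarrow>\<^sub>M CM" for N
    using \<mu> \<nu> by (simp_all add: space_counting_measure_algebra)
  note [measurable] = this
  \<comment> \<open>\<open>?H\<close> takes the configuration that is left after the removal of
    \<open>x\<close>; joint measurability in both arguments makes it an admissible integrand for the
    outer product rule.\<close>
  let ?H = "\<lambda>x \<mu>. \<integral>\<^sup>+y. g (x, y) (remove_point y \<mu>) \<partial>\<mu>"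
  have "(\<lambda>p. \<integral>\<^sup>+y. g (fst p, y) (remove_point y (snd p)) \<partial>snd p) \<in> borel_measurable (borel \<Otimes>\<^sub>M CM)"
    by (rule nn_integral_measurable_CM) measurable
  then have H: "(\<lambda>(x, \<mu>). ?H x \<mu>) \<in> borel_measurable (borel \<Otimes>\<^sub>M CM)"
    by (simp add: case_prod_beta')
  have Hadd: "?H x (a \<oplus>\<^sub>M b) = (\<integral>\<^sup>+y. g (x, y) (remove_point y a \<oplus>\<^sub>M b) \<partial>a)
      + (\<integral>\<^sup>+y. g (x, y) (a \<oplus>\<^sub>M remove_point y b) \<partial>b)"
    if "a \<in> counting_measures" "b \<in> counting_measures" for a b x
    using that by (rule nn_integral_remove_point_add) measurable
  have mm: "(\<lambda>x. \<integral>\<^sup>+y. F x y \<partial>k x) \<in> borel_measurable L"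
    if "(\<lambda>(x, y). F x y) \<in> borel_measurable (borel \<Otimes>\<^sub>M borel)" "k \<in> borel \<rightarrow>\<^sub>M CM" "sets L = sets borel"
    for F :: "'a \<Rightarrow> 'a \<Rightarrow> ennreal" and k and L :: "'a measure"
    using nn_integral_measurable_CM[OF that(2,1)] that(3) by (simp cong: measurable_cong_sets)
  have m: "(\<lambda>(x, y). g (x, y) (remove_point y (remove_point x \<mu>) \<oplus>\<^sub>M \<nu>)) \<in> borel_measurable (borel \<Otimes>\<^sub>M borel)"
    "(\<lambda>(x, y). g (x, y) (remove_point x \<mu> \<oplus>\<^sub>M remove_point y \<nu>)) \<in> borel_measurable (borel \<Otimes>\<^sub>M borel)"
    "(\<lambda>(x, y). g (x, y) (remove_point y \<mu> \<oplus>\<^sub>M remove_point x \<nu>)) \<in> borel_measurable (borel \<Otimes>\<^sub>M borel)"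
    "(\<lambda>(x, y). g (x, y) (\<mu> \<oplus>\<^sub>M remove_point y (remove_point x \<nu>))) \<in> borel_measurable (borel \<Otimes>\<^sub>M borel)"
    by measurable
  have r: "(\<lambda>x. remove_point x \<mu>) \<in> borel \<rightarrow>\<^sub>M CM" "(\<lambda>x. remove_point x \<nu>) \<in> borel \<rightarrow>\<^sub>M CM"
    by measurable
  have gadd: "(\<lambda>(z, \<mu>). g z (\<mu> \<oplus>\<^sub>M \<nu>)) \<in> borel_measurable (borel \<Otimes>\<^sub>M CM)"
    "(\<lambda>(z, \<nu>). g z (\<mu> \<oplus>\<^sub>M \<nu>)) \<in> borel_measurable (borel \<Otimes>\<^sub>M CM)"
    by measurable
  have "(\<integral>\<^sup>+z. g z (remove_pair z (\<mu> \<oplus>\<^sub>M \<nu>)) \<partial>second_factorial_measure (\<mu> \<oplus>\<^sub>M \<nu>))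
    = (\<integral>\<^sup>+x. ?H x (remove_point x (\<mu> \<oplus>\<^sub>M \<nu>)) \<partial>(\<mu> \<oplus>\<^sub>M \<nu>))"
    by (rule nn_integral_remove_pair[OF add_measure_counting_measures[OF \<mu> \<nu>] g])
  also have "\<dots> = (\<integral>\<^sup>+x. ?H x (remove_point x \<mu> \<oplus>\<^sub>M \<nu>) \<partial>\<mu>) + (\<integral>\<^sup>+x. ?H x (\<mu> \<oplus>\<^sub>M remove_point x \<nu>) \<partial>\<nu>)"
    by (rule nn_integral_remove_point_add[OF \<mu> \<nu> H])
  also have "(\<integral>\<^sup>+x. ?H x (remove_point x \<mu> \<oplus>\<^sub>M \<nu>) \<partial>\<mu>)
    = (\<integral>\<^sup>+x. \<integral>\<^sup>+y. g (x, y) (remove_point y (remove_point x \<mu>) \<oplus>\<^sub>M \<nu>) \<partial>remove_point x \<mu> \<partial>\<mu>)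
    + (\<integral>\<^sup>+x. \<integral>\<^sup>+y. g (x, y) (remove_point x \<mu> \<oplus>\<^sub>M remove_point y \<nu>) \<partial>\<nu> \<partial>\<mu>)"
    unfolding Hadd[OF remove_point_counting_measures[OF \<mu>] \<nu>]
    by (rule nn_integral_add[OF mm[OF m(1) r(1)] mm[OF m(2) c2]]) simp_all
  also have "(\<integral>\<^sup>+x. \<integral>\<^sup>+y. g (x, y) (remove_point y (remove_point x \<mu>) \<oplus>\<^sub>M \<nu>) \<partial>remove_point x \<mu> \<partial>\<mu>)
    = (\<integral>\<^sup>+z. g z (remove_pair z \<mu> \<oplus>\<^sub>M \<nu>) \<partial>second_factorial_measure \<mu>)"
    by (rule nn_integral_remove_pair[OF \<mu> gadd(1), symmetric])
  also have "(\<integral>\<^sup>+x. ?H x (\<mu> \<oplus>\<^sub>M remove_point x \<nu>) \<partial>\<nu>)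
    = (\<integral>\<^sup>+x. \<integral>\<^sup>+y. g (x, y) (remove_point y \<mu> \<oplus>\<^sub>M remove_point x \<nu>) \<partial>\<mu> \<partial>\<nu>)
    + (\<integral>\<^sup>+x. \<integral>\<^sup>+y. g (x, y) (\<mu> \<oplus>\<^sub>M remove_point y (remove_point x \<nu>)) \<partial>remove_point x \<nu> \<partial>\<nu>)"
    unfolding Hadd[OF \<mu> remove_point_counting_measures[OF \<nu>]]
    by (rule nn_integral_add[OF mm[OF m(3) c1] mm[OF m(4) r(2)]]) simp_all
  also have "(\<integral>\<^sup>+x. \<integral>\<^sup>+y. g (x, y) (\<mu> \<oplus>\<^sub>M remove_point y (remove_point x \<nu>)) \<partial>remove_point x \<nu> \<partial>\<nu>)
    = (\<integral>\<^sup>+z. g z (\<mu> \<oplus>\<^sub>M remove_pair z \<nu>) \<partial>second_factorial_measure \<nu>)"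
    by (rule nn_integral_remove_pair[OF \<nu> gadd(2), symmetric])
  finally show ?thesis by (simp only: add.assoc)
qed

section \<open>Palm formulas for independent sums\<close>

lemma prob_algebraD:
  assumes "M \<in> space (prob_algebra N)"
  shows "sets M = sets N" "space M = space N" "prob_space M" "sigma_finite_measure M"
proof -
  show "sets M = sets N" "prob_space M" using assms by (simp_all add: space_prob_algebra)
  then show "space M = space N" "sigma_finite_measure M"
    using sets_eq_imp_space_eq[of M N] prob_space_imp_sigma_finite[of M] by blast+
qed

lemma measurable_reduced_palm [measurable (raw)]:
  fixes K :: "'a::polish_space \<Rightarrow> 'a measure measure"
  assumes [measurable]: "K \<in> borel \<rightarrow>\<^sub>M prob_algebra CM" "h \<in> N \<rightarrow>\<^sub>M borel"
  shows "(\<lambda>w. reduced_palm K (h w)) \<in> N \<rightarrow>\<^sub>M prob_algebra CM"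
  unfolding reduced_palm_def by measurable

lemma measurable_indep_sum_law [measurable (raw)]:
  assumes [measurable]: "f \<in> N \<rightarrow>\<^sub>M prob_algebra CM" "g \<in> N \<rightarrow>\<^sub>M prob_algebra CM"
  shows "(\<lambda>w. indep_sum_law (f w) (g w)) \<in> N \<rightarrow>\<^sub>M prob_algebra CM"
  unfolding indep_sum_law_def by measurable

text \<open>Both orders of integration are recorded since the Palm formulas below produce the first
  summand as the inner variable in one case and as the outer variable in the other.\<close>

lemma nn_integral_indep_sum_law:
  fixes Q R :: "'a::polish_space measure measure"
  assumes Q: "Q \<in> space (prob_algebra CM)" and R: "R \<in> space (prob_algebra CM)"
    and f[measurable]: "f \<in> borel_measurable CM"
  shows "(\<integral>\<^sup>+\<mu>. f \<mu> \<partial>indep_sum_law Q R) = (\<integral>\<^sup>+\<mu>. \<integral>\<^sup>+\<nu>. f (\<mu> \<oplus>\<^sub>M \<nu>) \<partial>R \<partial>Q)"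
    and "(\<integral>\<^sup>+\<mu>. f \<mu> \<partial>indep_sum_law Q R) = (\<integral>\<^sup>+\<nu>. \<integral>\<^sup>+\<mu>. f (\<mu> \<oplus>\<^sub>M \<nu>) \<partial>Q \<partial>R)"
proof -
  note [measurable_cong] = prob_algebraD(1)[OF Q] prob_algebraD(1)[OF R]
  interpret Q: sigma_finite_measure Q by (rule prob_algebraD(4)[OF Q])
  interpret R: sigma_finite_measure R by (rule prob_algebraD(4)[OF R])
  interpret pair_sigma_finite Q R ..
  have m: "(\<lambda>p. f (fst p \<oplus>\<^sub>M snd p)) \<in> borel_measurable (Q \<Otimes>\<^sub>M R)" by measurable
  have "(\<integral>\<^sup>+\<mu>. f \<mu> \<partial>indep_sum_law Q R) = (\<integral>\<^sup>+p. f (fst p \<oplus>\<^sub>M snd p) \<partial>(Q \<Otimes>\<^sub>M R))"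
    unfolding indep_sum_law_def by (subst nn_integral_distr) (simp_all add: case_prod_beta')
  with R.nn_integral_fst[OF m] nn_integral_snd[OF m]
  show "(\<integral>\<^sup>+\<mu>. f \<mu> \<partial>indep_sum_law Q R) = (\<integral>\<^sup>+\<mu>. \<integral>\<^sup>+\<nu>. f (\<mu> \<oplus>\<^sub>M \<nu>) \<partial>R \<partial>Q)"
    and "(\<integral>\<^sup>+\<mu>. f \<mu> \<partial>indep_sum_law Q R) = (\<integral>\<^sup>+\<nu>. \<integral>\<^sup>+\<mu>. f (\<mu> \<oplus>\<^sub>M \<nu>) \<partial>Q \<partial>R)"
    by simp_all
qed

lemma sets_indep_sum_law [simp]: "sets (indep_sum_law Q R) = sets CM"
  by (simp add: indep_sum_law_def)

lemma add_measure_commute_CM: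
  "\<mu> \<in> space CM \<Longrightarrow> \<nu> \<in> space CM \<Longrightarrow> \<mu> \<oplus>\<^sub>M \<nu> = \<nu> \<oplus>\<^sub>M \<mu>"
  by (intro add_measure_commute) (simp add: counting_measuresD(1)[OF counting_measures_if_space_CM])

text \<open>Needed where the roles of the two processes are exchanged, which produces the component
  laws with their factors in the opposite order.\<close>

lemma indep_sum_law_commute:
  fixes Q R :: "'a::polish_space measure measure"
  assumes Q: "Q \<in> space (prob_algebra CM)" and R: "R \<in> space (prob_algebra CM)"
  shows "indep_sum_law Q R = indep_sum_law R Q"
proof (rule measure_eqI)
  fix L assume "L \<in> sets (indep_sum_law Q R)"
  then have L: "L \<in> sets CM" by simp
  then have m: "indicator L \<in> borel_measurable CM" by simp
  have "emeasure (indep_sum_law Q R) L = (\<integral>\<^sup>+\<mu>. indicator L \<mu> \<partial>indep_sum_law Q R)"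
    using L by simp
  also have "\<dots> = (\<integral>\<^sup>+\<nu>. \<integral>\<^sup>+\<mu>. indicator L (\<mu> \<oplus>\<^sub>M \<nu>) \<partial>Q \<partial>R)"
    by (rule nn_integral_indep_sum_law(2)[OF Q R m])
  also have "\<dots> = (\<integral>\<^sup>+\<nu>. \<integral>\<^sup>+\<mu>. indicator L (\<nu> \<oplus>\<^sub>M \<mu>) \<partial>Q \<partial>R)"
    by (intro nn_integral_cong)
      (simp add: prob_algebraD(2)[OF Q] prob_algebraD(2)[OF R] add_measure_commute_CM)
  also have "\<dots> = (\<integral>\<^sup>+\<mu>. indicator L \<mu> \<partial>indep_sum_law R Q)"
    by (rule nn_integral_indep_sum_law(1)[OF R Q m, symmetric])
  also have "\<dots> = emeasure (indep_sum_law R Q) L"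
    using L by simp
  finally show "emeasure (indep_sum_law Q R) L = emeasure (indep_sum_law R Q) L" .
qed simp

text \<open>The refined Campbell formula in reduced form. The left-hand side is written with the law
  of \<open>\<Phi>\<close> so that it can be nested with the law of a second, independent
  process.\<close>

lemma nn_integral_reduced_palm:
  fixes \<Phi> :: "'w \<Rightarrow> 'a::polish_space measure"
  assumes pp: "point_process P \<Phi>" and sf: "sigma_finite_measure (moment_measure P \<Phi>)"
    and K: "is_palm_kernel P \<Phi> K"
    and f[measurable]: "(\<lambda>(x, \<mu>). f x \<mu>) \<in> borel_measurable (borel \<Otimes>\<^sub>M CM)"
  shows "(\<integral>\<^sup>+\<mu>. \<integral>\<^sup>+x. f x (remove_point x \<mu>) \<partial>\<mu> \<partial>distr P CM \<Phi>)
    = (\<integral>\<^sup>+x. \<integral>\<^sup>+\<mu>. f x \<mu> \<partial>reduced_palm K x \<partial>moment_measure P \<Phi>)"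
proof -
  have \<Phi>[measurable]: "\<Phi> \<in> P \<rightarrow>\<^sub>M CM" using pp by (simp add: point_process_def)
  have Km[measurable]: "K \<in> borel \<rightarrow>\<^sub>M prob_algebra CM" using K by (simp add: is_palm_kernel_def)
  note \<Phi>D = counting_measuresD[OF counting_measures_if_space_CM[OF measurable_space[OF \<Phi>]]]
  have "(\<integral>\<^sup>+\<mu>. \<integral>\<^sup>+x. f x (remove_point x \<mu>) \<partial>\<mu> \<partial>distr P CM \<Phi>)
      = (\<integral>\<^sup>+\<omega>. \<integral>\<^sup>+x. f x (remove_point x (\<Phi> \<omega>)) \<partial>\<Phi> \<omega> \<partial>P)"
  proof (rule nn_integral_distr[OF \<Phi>])
    show "(\<lambda>\<mu>. \<integral>\<^sup>+x. f x (remove_point x \<mu>) \<partial>\<mu>) \<in> borel_measurable (distr P CM \<Phi>)"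
      by (rule nn_integral_measurable_CM) measurable
  qed
  also have "\<dots> = (\<integral>\<^sup>+x. \<integral>\<^sup>+\<mu>. f x (remove_point x \<mu>) \<partial>K x \<partial>moment_measure P \<Phi>)"
  \<comment> \<open>The kernel \<open>K\<close> describes the configuration including its point at
    \<open>x\<close>, so \<open>h\<close> ignores the point and the removal is put into the
    integrand; pushing \<open>K x\<close> forward under it gives
    \<open>reduced_palm K x\<close>.\<close>
  proof (rule disintegration_nn_integral[where h="\<lambda>\<omega> x. \<Phi> \<omega>" and k=\<Phi> and f="\<lambda>p. f (fst p) (remove_point (fst p) (snd p))",
        unfolded fst_conv snd_conv])
    show "sets (\<Phi> w) = sets borel" if "w \<in> space P" for w using \<Phi>D(1)[OF that] .
    show "(\<lambda>x. \<Phi> w) \<in> borel \<rightarrow>\<^sub>M CM" if "w \<in> space P" for w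
      using measurable_space[OF \<Phi> that] by simp
    show "(\<lambda>w. \<integral>\<^sup>+z. g (z, \<Phi> w) \<partial>\<Phi> w) \<in> borel_measurable P"
      if [measurable]: "g \<in> borel_measurable (borel \<Otimes>\<^sub>M CM)" for g
      by (rule nn_integral_measurable_CM) measurable
    show "(\<lambda>p. f (fst p) (remove_point (fst p) (snd p))) \<in> borel_measurable (borel \<Otimes>\<^sub>M CM)"
      by measurable
    show "K \<in> borel \<rightarrow>\<^sub>M prob_algebra CM" by fact
    fix A :: "'a set" and L :: "'a measure set" assume A: "A \<in> sets borel" and L: "L \<in> sets CM"
    have "(\<integral>\<^sup>+\<omega>. \<integral>\<^sup>+z. indicator A z * indicator L (\<Phi> \<omega>) \<partial>\<Phi> \<omega> \<partial>P)
      = (\<integral>\<^sup>+\<omega>. emeasure (\<Phi> \<omega>) A * indicator L (\<Phi> \<omega>) \<partial>P)"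
    proof (rule nn_integral_cong)
      fix \<omega> assume "\<omega> \<in> space P"
      then have "A \<in> sets (\<Phi> \<omega>)" using A \<Phi>D(1) by simp
      then show "(\<integral>\<^sup>+z. indicator A z * indicator L (\<Phi> \<omega>) \<partial>\<Phi> \<omega>) = emeasure (\<Phi> \<omega>) A * indicator L (\<Phi> \<omega>)"
        by (subst nn_integral_multc) simp_all
    qed
    also have "\<dots> = (\<integral>\<^sup>+x\<in>A. emeasure (K x) L \<partial>moment_measure P \<Phi>)"
      using K A L by (simp add: is_palm_kernel_def)
    finally show "(\<integral>\<^sup>+\<omega>. \<integral>\<^sup>+z. indicator A z * indicator L (\<Phi> \<omega>) \<partial>\<Phi> \<omega> \<partial>P) = \<dots>" .
  qed (use sf in simp_all)
  also have "\<dots> = (\<integral>\<^sup>+x. \<integral>\<^sup>+\<mu>. f x \<mu> \<partial>reduced_palm K x \<partial>moment_measure P \<Phi>)"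
  proof (rule nn_integral_cong)
    fix x :: 'a
    have "K x \<in> space (prob_algebra CM)" using measurable_space[OF Km] by simp
    note [measurable_cong] = prob_algebraD(1)[OF this]
    show "(\<integral>\<^sup>+\<mu>. f x (remove_point x \<mu>) \<partial>K x) = (\<integral>\<^sup>+\<mu>. f x \<mu> \<partial>reduced_palm K x)"
      unfolding reduced_palm_def by (subst nn_integral_distr) simp_all
  qed
  finally show ?thesis .
qed

text \<open>The two-point kernel is given in reduced form, so here the removal belongs to the
  configuration map \<open>h\<close> of the disintegration and no push-forward remains to be
  taken.\<close>

lemma nn_integral_reduced_palm_pair:
  fixes \<Phi> :: "'w \<Rightarrow> 'a::polish_space measure"
  assumes pp: "point_process P \<Phi>" and sf: "sigma_finite_measure (second_factorial_moment_measure P \<Phi>)"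
    and R: "is_reduced_palm_kernel2 P \<Phi> R"
    and g[measurable]: "(\<lambda>(z, \<mu>). g z \<mu>) \<in> borel_measurable (borel \<Otimes>\<^sub>M CM)"
  shows "(\<integral>\<^sup>+\<mu>. \<integral>\<^sup>+z. g z (remove_pair z \<mu>) \<partial>second_factorial_measure \<mu> \<partial>distr P CM \<Phi>)
    = (\<integral>\<^sup>+z. \<integral>\<^sup>+\<mu>. g z \<mu> \<partial>R z \<partial>second_factorial_moment_measure P \<Phi>)"
proof -
  have \<Phi>[measurable]: "\<Phi> \<in> P \<rightarrow>\<^sub>M CM" using pp by (simp add: point_process_def)
  have Rm[measurable]: "R \<in> borel \<rightarrow>\<^sub>M prob_algebra CM" using R by (simp add: is_reduced_palm_kernel2_def)
  have "(\<integral>\<^sup>+\<mu>. \<integral>\<^sup>+z. g z (remove_pair z \<mu>) \<partial>second_factorial_measure \<mu> \<partial>distr P CM \<Phi>)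
      = (\<integral>\<^sup>+\<omega>. \<integral>\<^sup>+z. g z (remove_pair z (\<Phi> \<omega>)) \<partial>second_factorial_measure (\<Phi> \<omega>) \<partial>P)"
  proof (rule nn_integral_distr[OF \<Phi>])
    show "(\<lambda>\<mu>. \<integral>\<^sup>+z. g z (remove_pair z \<mu>) \<partial>second_factorial_measure \<mu>) \<in> borel_measurable (distr P CM \<Phi>)"
      by (rule nn_integral_measurable_second_factorial) measurable
  qed
  also have "\<dots> = (\<integral>\<^sup>+z. \<integral>\<^sup>+\<mu>. g z \<mu> \<partial>R z \<partial>second_factorial_moment_measure P \<Phi>)"
  proof (rule disintegration_nn_integral[where h="\<lambda>\<omega> z. remove_pair z (\<Phi> \<omega>)"
        and k="\<lambda>\<omega>. second_factorial_measure (\<Phi> \<omega>)" and f="\<lambda>p. g (fst p) (snd p)",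
        unfolded fst_conv snd_conv])
    show "(\<lambda>z. remove_pair z (\<Phi> w)) \<in> borel \<rightarrow>\<^sub>M CM" if "w \<in> space P" for w
    proof -
      have [measurable]: "(\<lambda>_. \<Phi> w) \<in> (borel :: ('a \<times> 'a) measure) \<rightarrow>\<^sub>M CM"
        using measurable_space[OF \<Phi> that] by simp
      show ?thesis by measurable
    qed
    show "(\<lambda>w. \<integral>\<^sup>+z. g (z, remove_pair z (\<Phi> w)) \<partial>second_factorial_measure (\<Phi> w)) \<in> borel_measurable P"
      if [measurable]: "g \<in> borel_measurable (borel \<Otimes>\<^sub>M CM)" for g
      by (rule nn_integral_measurable_second_factorial) measurable
    show "(\<lambda>p. g (fst p) (snd p)) \<in> borel_measurable (borel \<Otimes>\<^sub>M CM)"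
      by measurable
    show "R \<in> borel \<rightarrow>\<^sub>M prob_algebra CM" by fact
    fix A :: "('a \<times> 'a) set" and L :: "'a measure set" assume A: "A \<in> sets borel" and L: "L \<in> sets CM"
    show "(\<integral>\<^sup>+\<omega>. \<integral>\<^sup>+z. indicator A z * indicator L (remove_pair z (\<Phi> \<omega>)) \<partial>second_factorial_measure (\<Phi> \<omega>) \<partial>P)
      = (\<integral>\<^sup>+z\<in>A. emeasure (R z) L \<partial>second_factorial_moment_measure P \<Phi>)"
      using R A L by (simp add: is_reduced_palm_kernel2_def remove_pair_def mult.commute)
  qed (use sf in simp_all)
  finally show ?thesis .
qed

text \<open>With \<open>\<nu>\<close> frozen, adding it is a change of the integrand only, to which
  the Palm formula for \<open>\<Phi>\<close> applies. The exchange of the integrals over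
  \<open>\<nu>\<close> and \<open>z\<close> then brings the two configurations together; it rests on
  sigma-finiteness of the second factorial moment measure.\<close>

lemma nn_integral_reduced_palm_pair_add:
  fixes \<Phi> :: "'w \<Rightarrow> 'a::polish_space measure"
  assumes pp: "point_process P \<Phi>" and sf: "sigma_finite_measure (second_factorial_moment_measure P \<Phi>)"
    and R: "is_reduced_palm_kernel2 P \<Phi> R" and Q: "Q \<in> space (prob_algebra CM)"
    and g[measurable]: "(\<lambda>(z, \<mu>). g z \<mu>) \<in> borel_measurable (borel \<Otimes>\<^sub>M CM)"
  shows "(\<integral>\<^sup>+\<nu>. \<integral>\<^sup>+\<mu>. \<integral>\<^sup>+z. g z (remove_pair z \<mu> \<oplus>\<^sub>M \<nu>) \<partial>second_factorial_measure \<mu> \<partial>distr P CM \<Phi> \<partial>Q)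
    = (\<integral>\<^sup>+z. \<integral>\<^sup>+\<mu>. g z \<mu> \<partial>indep_sum_law (R z) Q \<partial>second_factorial_moment_measure P \<Phi>)"
proof -
  let ?M = "second_factorial_moment_measure P \<Phi>"
  note [measurable_cong] = prob_algebraD(1)[OF Q]
  interpret M: sigma_finite_measure ?M by (rule sf)
  interpret Q: sigma_finite_measure Q by (rule prob_algebraD(4)[OF Q])
  interpret pair_sigma_finite Q ?M ..
  have Rm[measurable]: "R \<in> borel \<rightarrow>\<^sub>M prob_algebra CM" using R by (simp add: is_reduced_palm_kernel2_def)
  note Rs[measurable] = measurable_prob_algebraD[OF Rm]
  have Rz: "R z \<in> space (prob_algebra CM)" for z using measurable_space[OF Rm] by simp
  have "(\<integral>\<^sup>+\<nu>. \<integral>\<^sup>+\<mu>. \<integral>\<^sup>+z. g z (remove_pair z \<mu> \<oplus>\<^sub>M \<nu>) \<partial>second_factorial_measure \<mu> \<partial>distr P CM \<Phi> \<partial>Q)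
    = (\<integral>\<^sup>+\<nu>. \<integral>\<^sup>+z. \<integral>\<^sup>+\<mu>. g z (\<mu> \<oplus>\<^sub>M \<nu>) \<partial>R z \<partial>?M \<partial>Q)"
  proof (rule nn_integral_cong)
    fix \<nu> assume "\<nu> \<in> space Q"
    then have "\<nu> \<in> space CM" using prob_algebraD(2)[OF Q] by simp
    then have [measurable]: "(\<lambda>_. \<nu>) \<in> (borel \<Otimes>\<^sub>M CM :: (('a \<times> 'a) \<times> 'a measure) measure) \<rightarrow>\<^sub>M CM" by simp
    have "(\<lambda>(z, \<mu>). g z (\<mu> \<oplus>\<^sub>M \<nu>)) \<in> borel_measurable (borel \<Otimes>\<^sub>M CM)"
      by measurable
    then show "(\<integral>\<^sup>+\<mu>. \<integral>\<^sup>+z. g z (remove_pair z \<mu> \<oplus>\<^sub>M \<nu>) \<partial>second_factorial_measure \<mu> \<partial>distr P CM \<Phi>)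
      = (\<integral>\<^sup>+z. \<integral>\<^sup>+\<mu>. g z (\<mu> \<oplus>\<^sub>M \<nu>) \<partial>R z \<partial>?M)"
      by (rule nn_integral_reduced_palm_pair[OF pp sf R])
  qed
  also have "\<dots> = (\<integral>\<^sup>+z. \<integral>\<^sup>+\<nu>. \<integral>\<^sup>+\<mu>. g z (\<mu> \<oplus>\<^sub>M \<nu>) \<partial>R z \<partial>Q \<partial>?M)"
  proof (rule Fubini'[symmetric])
    have "(\<lambda>p. \<integral>\<^sup>+\<mu>. g (snd p) (\<mu> \<oplus>\<^sub>M fst p) \<partial>R (snd p)) \<in> borel_measurable (CM \<Otimes>\<^sub>M borel)"
      by (rule nn_integral_measurable_subprob_algebra2[where N=CM]) measurable
    then show "(\<lambda>(\<nu>, z). \<integral>\<^sup>+\<mu>. g z (\<mu> \<oplus>\<^sub>M \<nu>) \<partial>R z) \<in> borel_measurable (Q \<Otimes>\<^sub>M ?M)"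
      by (simp add: case_prod_beta' cong: measurable_cong_sets)
  qed
  also have "\<dots> = (\<integral>\<^sup>+z. \<integral>\<^sup>+\<mu>. g z \<mu> \<partial>indep_sum_law (R z) Q \<partial>?M)"
    using Rz Q by (intro nn_integral_cong nn_integral_indep_sum_law(2)[symmetric]) measurable
  finally show ?thesis .
qed

text \<open>Each process contributes one point, so the one-point formula is used twice: for
  \<open>x\<close> with \<open>\<nu>\<close> frozen, then for \<open>y\<close> with \<open>x\<close>
  and the reduced configuration at \<open>x\<close> frozen. Since \<open>\<nu>\<close> is both the
  integrating measure for \<open>y\<close> and a summand, its law must be moved next to the integral
  over \<open>y\<close> in between.\<close>

lemma nn_integral_reduced_palms_add:
  fixes \<Phi>1 \<Phi>2 :: "'w \<Rightarrow> 'a::polish_space measure"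
  assumes pp: "point_process P \<Phi>1" "point_process P \<Phi>2"
    and sf: "sigma_finite_measure (moment_measure P \<Phi>1)" "sigma_finite_measure (moment_measure P \<Phi>2)"
    and K: "is_palm_kernel P \<Phi>1 K1" "is_palm_kernel P \<Phi>2 K2"
    and g[measurable]: "(\<lambda>(z, \<mu>). g z \<mu>) \<in> borel_measurable (borel \<Otimes>\<^sub>M CM)"
  shows "(\<integral>\<^sup>+\<nu>. \<integral>\<^sup>+\<mu>. \<integral>\<^sup>+x. \<integral>\<^sup>+y. g (x, y) (remove_point x \<mu> \<oplus>\<^sub>M remove_point y \<nu>) \<partial>\<nu> \<partial>\<mu>
        \<partial>distr P CM \<Phi>1 \<partial>distr P CM \<Phi>2)
    = (\<integral>\<^sup>+z. \<integral>\<^sup>+\<mu>. g z \<mu> \<partial>indep_sum_law (reduced_palm K1 (fst z)) (reduced_palm K2 (snd z))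
        \<partial>(moment_measure P \<Phi>1 \<Otimes>\<^sub>M moment_measure P \<Phi>2))"
proof -
  let ?M1 = "moment_measure P \<Phi>1" and ?M2 = "moment_measure P \<Phi>2"
  let ?Q1 = "distr P CM \<Phi>1" and ?Q2 = "distr P CM \<Phi>2"
  let ?K1 = "reduced_palm K1" and ?K2 = "reduced_palm K2"
  have \<Phi>[measurable]: "\<Phi>1 \<in> P \<rightarrow>\<^sub>M CM" "\<Phi>2 \<in> P \<rightarrow>\<^sub>M CM" and "prob_space P"
    using pp by (simp_all add: point_process_def)
  interpret P: prob_space P by fact
  interpret Q2: prob_space ?Q2 by (rule P.prob_space_distr) measurable
  interpret M1: sigma_finite_measure ?M1 by (rule sf)
  interpret M2: sigma_finite_measure ?M2 by (rule sf)
  interpret QM: pair_sigma_finite ?Q2 ?M1 ..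
  have Km[measurable]: "K1 \<in> borel \<rightarrow>\<^sub>M prob_algebra CM" "K2 \<in> borel \<rightarrow>\<^sub>M prob_algebra CM"
    using K by (simp_all add: is_palm_kernel_def)
  have Ks[measurable (raw)]: "(\<lambda>w. ?K1 (h w)) \<in> N \<rightarrow>\<^sub>M subprob_algebra CM" "(\<lambda>w. ?K2 (h w)) \<in> N \<rightarrow>\<^sub>M subprob_algebra CM"
    if "h \<in> N \<rightarrow>\<^sub>M borel" for h and N :: "'c measure"
    using that by (auto intro!: measurable_prob_algebraD measurable_reduced_palm Km)
  have "?K1 \<in> borel \<rightarrow>\<^sub>M prob_algebra CM" "?K2 \<in> borel \<rightarrow>\<^sub>M prob_algebra CM"
    by measurable
  from this[THEN measurable_space]
  have Kx: "?K1 x \<in> space (prob_algebra CM)" "?K2 x \<in> space (prob_algebra CM)" for x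
    by simp_all
  note Kc[measurable_cong] = prob_algebraD(1)[OF Kx(1)] prob_algebraD(1)[OF Kx(2)]
  have "(\<integral>\<^sup>+\<nu>. \<integral>\<^sup>+\<mu>. \<integral>\<^sup>+x. \<integral>\<^sup>+y. g (x, y) (remove_point x \<mu> \<oplus>\<^sub>M remove_point y \<nu>) \<partial>\<nu> \<partial>\<mu> \<partial>?Q1 \<partial>?Q2)
    = (\<integral>\<^sup>+\<nu>. \<integral>\<^sup>+x. \<integral>\<^sup>+\<mu>. \<integral>\<^sup>+y. g (x, y) (\<mu> \<oplus>\<^sub>M remove_point y \<nu>) \<partial>\<nu> \<partial>?K1 x \<partial>?M1 \<partial>?Q2)"
  proof (rule nn_integral_cong)
    fix \<nu> assume "\<nu> \<in> space ?Q2"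
    then have \<nu>: "\<nu> \<in> space CM" by simp
    have c: "(\<lambda>_. \<nu>) \<in> (borel \<Otimes>\<^sub>M CM :: ('a \<times> 'a measure) measure) \<rightarrow>\<^sub>M CM"
      and [measurable]: "(\<lambda>_. \<nu>) \<in> ((borel \<Otimes>\<^sub>M CM) \<Otimes>\<^sub>M borel :: (('a \<times> 'a measure) \<times> 'a) measure) \<rightarrow>\<^sub>M CM"
      using \<nu> by simp_all
    have "(\<lambda>p. \<integral>\<^sup>+y. g (fst p, y) (snd p \<oplus>\<^sub>M remove_point y \<nu>) \<partial>\<nu>) \<in> borel_measurable (borel \<Otimes>\<^sub>M CM)"
      by (rule nn_integral_measurable_CM[OF c]) measurable
    then show "(\<integral>\<^sup>+\<mu>. \<integral>\<^sup>+x. \<integral>\<^sup>+y. g (x, y) (remove_point x \<mu> \<oplus>\<^sub>M remove_point y \<nu>) \<partial>\<nu> \<partial>\<mu> \<partial>?Q1)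
        = (\<integral>\<^sup>+x. \<integral>\<^sup>+\<mu>. \<integral>\<^sup>+y. g (x, y) (\<mu> \<oplus>\<^sub>M remove_point y \<nu>) \<partial>\<nu> \<partial>?K1 x \<partial>?M1)"
      by (intro nn_integral_reduced_palm[OF pp(1) sf(1) K(1)]) (simp add: case_prod_beta')
  qed
  \<comment> \<open>The law of \<open>\<Phi>2\<close> is moved past \<open>x\<close> here and past
    the reduced configuration below, until it stands directly outside the integral against
    \<open>\<nu>\<close>.\<close>
  also have "\<dots> = (\<integral>\<^sup>+x. \<integral>\<^sup>+\<nu>. \<integral>\<^sup>+\<mu>. \<integral>\<^sup>+y. g (x, y) (\<mu> \<oplus>\<^sub>M remove_point y \<nu>) \<partial>\<nu> \<partial>?K1 x \<partial>?Q2 \<partial>?M1)"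
  proof (rule QM.Fubini'[symmetric])
    have "(\<lambda>q. \<integral>\<^sup>+y. g (snd (fst q), y) (snd q \<oplus>\<^sub>M remove_point y (fst (fst q))) \<partial>fst (fst q))
        \<in> borel_measurable ((CM \<Otimes>\<^sub>M borel) \<Otimes>\<^sub>M CM)"
      by (rule nn_integral_measurable_CM) measurable
    then have "(\<lambda>p. \<integral>\<^sup>+\<mu>. \<integral>\<^sup>+y. g (snd p, y) (\<mu> \<oplus>\<^sub>M remove_point y (fst p)) \<partial>fst p \<partial>?K1 (snd p))
        \<in> borel_measurable (CM \<Otimes>\<^sub>M borel)"
      by (intro nn_integral_measurable_subprob_algebra2[where N=CM] Ks) (simp_all add: case_prod_beta')
    then show "(\<lambda>(\<nu>, x). \<integral>\<^sup>+\<mu>. \<integral>\<^sup>+y. g (x, y) (\<mu> \<oplus>\<^sub>M remove_point y \<nu>) \<partial>\<nu> \<partial>?K1 x)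
        \<in> borel_measurable (?Q2 \<Otimes>\<^sub>M ?M1)"
      by (simp add: case_prod_beta' cong: measurable_cong_sets)
  qed
  also have "\<dots> = (\<integral>\<^sup>+x. \<integral>\<^sup>+y. \<integral>\<^sup>+\<mu>. g (x, y) \<mu> \<partial>indep_sum_law (?K1 x) (?K2 y) \<partial>?M2 \<partial>?M1)"
  proof (rule nn_integral_cong)
    fix x :: 'a
    interpret K1: prob_space "?K1 x" by (rule prob_algebraD(3)[OF Kx(1)])
    interpret QK: pair_sigma_finite ?Q2 "?K1 x" ..
    interpret MK: pair_sigma_finite ?M2 "?K1 x" ..
    have "(\<integral>\<^sup>+\<nu>. \<integral>\<^sup>+\<mu>. \<integral>\<^sup>+y. g (x, y) (\<mu> \<oplus>\<^sub>M remove_point y \<nu>) \<partial>\<nu> \<partial>?K1 x \<partial>?Q2)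
      = (\<integral>\<^sup>+\<mu>. \<integral>\<^sup>+\<nu>. \<integral>\<^sup>+y. g (x, y) (\<mu> \<oplus>\<^sub>M remove_point y \<nu>) \<partial>\<nu> \<partial>?Q2 \<partial>?K1 x)"
    proof (rule QK.Fubini'[symmetric])
      have "(\<lambda>p. \<integral>\<^sup>+y. g (x, y) (snd p \<oplus>\<^sub>M remove_point y (fst p)) \<partial>fst p) \<in> borel_measurable (CM \<Otimes>\<^sub>M CM)"
        by (rule nn_integral_measurable_CM) measurable
      then show "(\<lambda>(\<nu>, \<mu>). \<integral>\<^sup>+y. g (x, y) (\<mu> \<oplus>\<^sub>M remove_point y \<nu>) \<partial>\<nu>) \<in> borel_measurable (?Q2 \<Otimes>\<^sub>M ?K1 x)"
        using Kc(1)[of x] by (simp add: case_prod_beta' cong: measurable_cong_sets)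
    qed
    also have "\<dots> = (\<integral>\<^sup>+\<mu>. \<integral>\<^sup>+y. \<integral>\<^sup>+\<nu>. g (x, y) (\<mu> \<oplus>\<^sub>M \<nu>) \<partial>?K2 y \<partial>?M2 \<partial>?K1 x)"
    proof (rule nn_integral_cong)
      fix \<mu> assume "\<mu> \<in> space (?K1 x)"
      then have "\<mu> \<in> space CM" using prob_algebraD(2)[OF Kx(1)] by simp
      then have [measurable]: "(\<lambda>_. \<mu>) \<in> (borel \<Otimes>\<^sub>M CM :: ('a \<times> 'a measure) measure) \<rightarrow>\<^sub>M CM" by simp
      have "(\<lambda>(y, \<nu>). g (x, y) (\<mu> \<oplus>\<^sub>M \<nu>)) \<in> borel_measurable (borel \<Otimes>\<^sub>M CM)" by measurable
      then show "(\<integral>\<^sup>+\<nu>. \<integral>\<^sup>+y. g (x, y) (\<mu> \<oplus>\<^sub>M remove_point y \<nu>) \<partial>\<nu> \<partial>?Q2)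
          = (\<integral>\<^sup>+y. \<integral>\<^sup>+\<nu>. g (x, y) (\<mu> \<oplus>\<^sub>M \<nu>) \<partial>?K2 y \<partial>?M2)"
        by (rule nn_integral_reduced_palm[OF pp(2) sf(2) K(2)])
    qed
    \<comment> \<open>The integral over \<open>y\<close> is moved outwards again, so that the two
      reduced configurations at \<open>x\<close> and \<open>y\<close> stand innermost and form the
      law of an independent sum.\<close>
    also have "\<dots> = (\<integral>\<^sup>+y. \<integral>\<^sup>+\<mu>. \<integral>\<^sup>+\<nu>. g (x, y) (\<mu> \<oplus>\<^sub>M \<nu>) \<partial>?K2 y \<partial>?K1 x \<partial>?M2)"
    proof (rule MK.Fubini')
      have "(\<lambda>p. \<integral>\<^sup>+\<nu>. g (x, fst p) (snd p \<oplus>\<^sub>M \<nu>) \<partial>?K2 (fst p)) \<in> borel_measurable (borel \<Otimes>\<^sub>M CM)"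
        by (rule nn_integral_measurable_subprob_algebra2[where N=CM, OF _ Ks(2)]) measurable
      then show "(\<lambda>(y, \<mu>). \<integral>\<^sup>+\<nu>. g (x, y) (\<mu> \<oplus>\<^sub>M \<nu>) \<partial>?K2 y) \<in> borel_measurable (?M2 \<Otimes>\<^sub>M ?K1 x)"
        using Kc(1)[of x] by (simp add: case_prod_beta' cong: measurable_cong_sets)
    qed
    also have "\<dots> = (\<integral>\<^sup>+y. \<integral>\<^sup>+\<mu>. g (x, y) \<mu> \<partial>indep_sum_law (?K1 x) (?K2 y) \<partial>?M2)"
      using Kx by (intro nn_integral_cong nn_integral_indep_sum_law(1)[symmetric]) measurable
    finally show "(\<integral>\<^sup>+\<nu>. \<integral>\<^sup>+\<mu>. \<integral>\<^sup>+y. g (x, y) (\<mu> \<oplus>\<^sub>M remove_point y \<nu>) \<partial>\<nu> \<partial>?K1 x \<partial>?Q2) = \<dots>" .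
  qed
  also have "\<dots> = (\<integral>\<^sup>+z. \<integral>\<^sup>+\<mu>. g z \<mu> \<partial>indep_sum_law (?K1 (fst z)) (?K2 (snd z)) \<partial>(?M1 \<Otimes>\<^sub>M ?M2))"
  proof -
    have "(\<lambda>z. indep_sum_law (?K1 (fst z)) (?K2 (snd z))) \<in> (borel :: ('a \<times> 'a) measure) \<rightarrow>\<^sub>M subprob_algebra CM"
      by (intro measurable_prob_algebraD) measurable
    then have "(\<lambda>z. \<integral>\<^sup>+\<mu>. g z \<mu> \<partial>indep_sum_law (?K1 (fst z)) (?K2 (snd z))) \<in> borel_measurable borel"
      by (rule nn_integral_measurable_subprob_algebra2[OF g])
    then have "(\<lambda>z. \<integral>\<^sup>+\<mu>. g z \<mu> \<partial>indep_sum_law (?K1 (fst z)) (?K2 (snd z))) \<in> borel_measurable (?M1 \<Otimes>\<^sub>M ?M2)"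
      by (simp add: borel_prod[symmetric] cong: measurable_cong_sets)
    from M2.nn_integral_fst[OF this] show ?thesis by simp
  qed
  finally show ?thesis .
qed

section \<open>The mixture formula\<close>

text \<open>The algebra is defined through all Borel sets; the conditions that the mass of
  \<open>V\<close> lies in \<open>U\<close>, with \<open>V\<close> from the exhausting family and
  \<open>U\<close> from a basis of \<open>ennreal\<close>, suffice. That the mass of every Borel set
  is measurable for the algebra they generate is a Dynkin-class argument, which needs finite masses
  for complements and therefore runs inside each \<open>V\<close>.\<close>

lemma countable_generator_CM:
  obtains E :: "'a::polish_space measure set set" where
    "countable E" "Int_stable E" "E \<subseteq> Pow (space CM)" "space CM \<in> E"
    "sets CM = sigma_sets (space CM) E"
proof -
  obtain \<V> :: "'a set set" where \<V>: "countable \<V>" "Int_stable \<V>" "UNIV \<in> \<V>" "sets borel = sigma_sets UNIV \<V>" and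
    exh: "\<And>\<mu>. \<mu> \<in> counting_measures \<Longrightarrow>
       \<exists>W::nat \<Rightarrow> 'a set. range W \<subseteq> \<V> \<and> incseq W \<and> (\<Union>n. W n) = UNIV \<and> (\<forall>n. emeasure \<mu> (W n) < \<infinity>)"
    by (rule countable_exhausting_family) blast
  have Vb: "V \<in> sets borel" if "V \<in> \<V>" for V using that \<V>(4) by auto
  obtain B :: "ennreal set set" where B: "countable B" "topological_basis B"
    using ex_countable_basis by blast
  have Bb: "U \<in> sets borel" if "U \<in> B" for U
    using topological_basis_open[OF B(2) that] by auto
  let ?\<Omega> = "space (CM :: 'a measure measure)"
  define X where "X = (\<lambda>(V, U). (\<lambda>\<mu>::'a measure. emeasure \<mu> V) -` U \<inter> ?\<Omega>) ` (\<V> \<times> B)"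
  \<comment> \<open>The factor \<open>?\<Omega>\<close> makes the empty intersection equal to the
    whole space.\<close>
  define E where "E = (\<lambda>F. ?\<Omega> \<inter> \<Inter>F) ` {F. finite F \<and> F \<subseteq> X}"
  have "countable X" unfolding X_def using \<V>(1) B(1) by auto
  then have "countable E" unfolding E_def by (intro countable_image countable_Collect_finite_subset)
  moreover have "Int_stable E"
  proof (rule Int_stableI)
    fix A A' assume "A \<in> E" "A' \<in> E"
    then obtain F G where "finite F" "F \<subseteq> X" "A = ?\<Omega> \<inter> \<Inter>F" "finite G" "G \<subseteq> X" "A' = ?\<Omega> \<inter> \<Inter>G"
      unfolding E_def by auto
    then show "A \<inter> A' \<in> E"
      unfolding E_def by (intro image_eqI[of _ _ "F \<union> G"]) auto
  qed
  moreover have EP: "E \<subseteq> Pow ?\<Omega>" unfolding E_def by auto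
  moreover have "?\<Omega> \<in> E" unfolding E_def by (intro image_eqI[of _ _ "{}"]) auto
  moreover have "sets CM = sigma_sets ?\<Omega> E"
  proof
    have Xs: "x \<in> sets CM" if x: "x \<in> X" for x
    proof -
      obtain V U where VU: "V \<in> \<V>" "U \<in> B" "x = (\<lambda>\<mu>. emeasure \<mu> V) -` U \<inter> ?\<Omega>"
        using x unfolding X_def by auto
      have "(\<lambda>\<mu>::'a measure. emeasure \<mu> V) \<in> borel_measurable CM"
        using measurable_emeasure_CM[OF measurable_ident Vb[OF VU(1)]] by simp
      then show ?thesis
        unfolding VU(3) using Bb[OF VU(2)] by (rule measurable_sets)
    qed
    have "e \<in> sets CM" if e: "e \<in> E" for e
    proof -
      obtain F where F: "finite F" "F \<subseteq> X" "e = ?\<Omega> \<inter> \<Inter>F" using e unfolding E_def by auto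
      show ?thesis
      proof (cases "F = {}")
        case False
        have "(\<Inter>x\<in>F. x) \<in> sets CM" using F Xs False by (intro sets.finite_INT) auto
        then show ?thesis unfolding F(3) by (intro sets.Int) simp_all
      qed (use F in simp)
    qed
    then show "sigma_sets ?\<Omega> E \<subseteq> sets CM" by (intro sets.sigma_sets_subset) auto
    let ?G = "sigma ?\<Omega> E"
    have spG: "space ?G = ?\<Omega>" by (rule space_measure_of[OF EP])
    have sG: "sets ?G = sigma_sets ?\<Omega> E" by (rule sets_measure_of[OF EP])
    have base: "(\<lambda>\<mu>::'a measure. emeasure \<mu> V) \<in> borel_measurable ?G" if V: "V \<in> \<V>" for V
    proof (rule measurable_sigma_sets)
      show "sets borel = sigma_sets UNIV B"
        by (subst borel_eq_countable_basis[OF B]) (simp add: sets_measure_of_conv)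
      fix U assume "U \<in> B"
      then have "(\<lambda>\<mu>::'a measure. emeasure \<mu> V) -` U \<inter> ?\<Omega> \<in> X"
        unfolding X_def using V by (intro image_eqI[of _ _ "(V, U)"]) auto
      then have "(\<lambda>\<mu>::'a measure. emeasure \<mu> V) -` U \<inter> ?\<Omega> \<in> E"
        unfolding E_def by (intro image_eqI[of _ _ "{(\<lambda>\<mu>::'a measure. emeasure \<mu> V) -` U \<inter> ?\<Omega>}"]) auto
      then show "(\<lambda>\<mu>::'a measure. emeasure \<mu> V) -` U \<inter> space ?G \<in> sets ?G"
        unfolding spG sG by (rule sigma_sets.Basic)
    qed auto
    \<comment> \<open>The default 0 for infinite mass of \<open>V\<close> keeps every such function
      below the mass of \<open>A\<close>, so the supremum over \<open>V\<close> recovers exactly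
      that mass.\<close>
    let ?e = "\<lambda>V A (\<mu>::'a measure). if emeasure \<mu> V < \<infinity> then emeasure \<mu> (A \<inter> V) else 0"
    have VP: "\<V> \<subseteq> Pow UNIV" by simp
    have loc: "?e V A \<in> borel_measurable ?G" if V: "V \<in> \<V>" and A: "A \<in> sigma_sets UNIV \<V>" for V A
      using \<V>(2) VP A
    proof (induction A rule: sigma_sets_induct_disjoint)
      case (basic A)
      then have "A \<inter> V \<in> \<V>" using V \<V>(2) by (auto simp: Int_stable_def)
      note base[OF this, measurable] base[OF V, measurable]
      show ?case by measurable
    next
      case empty
      have "?e V {} = (\<lambda>_. 0)" by (simp add: fun_eq_iff)
      then show ?case by (simp only: measurable_const space_borel UNIV_I)
    next
      case (compl A)
      note compl.IH[measurable] base[OF V, measurable]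
      have "(\<lambda>\<mu>. if emeasure \<mu> V < \<infinity> then emeasure \<mu> V - ?e V A \<mu> else 0) \<in> borel_measurable ?G"
        by measurable
      also have "?this \<longleftrightarrow> ?case"
      proof (rule measurable_cong)
        fix \<mu> assume "\<mu> \<in> space ?G"
        then have "\<mu> \<in> counting_measures" unfolding spG by (rule counting_measures_if_space_CM)
        note [simp] = counting_measuresD(1,2)[OF this]
        have b: "A \<in> sets borel" "V \<in> sets borel" using compl.hyps \<V>(4) Vb[OF V] by auto
        have "emeasure \<mu> ((UNIV - A) \<inter> V) = emeasure \<mu> V - emeasure \<mu> (A \<inter> V)" if "emeasure \<mu> V < \<infinity>"
        proof -
          have "(UNIV - A) \<inter> V = V - A \<inter> V" by auto
          moreover have "emeasure \<mu> (A \<inter> V) \<le> emeasure \<mu> V" using b by (intro emeasure_mono) auto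
          then have "emeasure \<mu> (A \<inter> V) \<noteq> \<infinity>" using that by (auto simp: top_unique)
          ultimately show ?thesis using b by (simp add: emeasure_Diff)
        qed
        then show "(if emeasure \<mu> V < \<infinity> then emeasure \<mu> V - ?e V A \<mu> else 0) = ?e V (UNIV - A) \<mu>"
          by simp
      qed
      finally show ?case .
    next
      case (union A)
      note union.IH[measurable]
      have "(\<lambda>\<mu>. \<Sum>i. ?e V (A i) \<mu>) \<in> borel_measurable ?G" by measurable
      also have "?this \<longleftrightarrow> ?case"
      proof (rule measurable_cong)
        fix \<mu> assume "\<mu> \<in> space ?G"
        then have "\<mu> \<in> counting_measures" unfolding spG by (rule counting_measures_if_space_CM)
        note [simp] = counting_measuresD(1,2)[OF this]
        have b: "A i \<in> sets borel" "V \<in> sets borel" for i using union.hyps \<V>(4) Vb[OF V] by auto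
        have "(\<Sum>i. emeasure \<mu> (A i \<inter> V)) = emeasure \<mu> (\<Union>i. A i \<inter> V)"
          using b union.hyps by (intro suminf_emeasure) (auto simp: disjoint_family_on_def)
        then show "(\<Sum>i. ?e V (A i) \<mu>) = ?e V (\<Union>i. A i) \<mu>"
          by simp
      qed
      finally show ?case .
    qed
    \<comment> \<open>Measurability of the identity into \<open>CM\<close> says that every set of
      \<open>CM\<close> belongs to the generated algebra.\<close>
    have "(\<lambda>\<mu>. \<mu>) \<in> ?G \<rightarrow>\<^sub>M CM"
    proof (rule measurable_into_CM)
      show "\<mu> \<in> counting_measures" if "\<mu> \<in> space ?G" for \<mu>
        using that unfolding spG by (rule counting_measures_if_space_CM)
      fix A :: "'a set" assume A: "A \<in> sets borel"
      have "(\<lambda>\<mu>. SUP V\<in>\<V>. ?e V A \<mu>) \<in> borel_measurable ?G"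
        using A \<V>(1,4) by (intro borel_measurable_SUP loc) auto
      also have "?this \<longleftrightarrow> (\<lambda>\<mu>. emeasure \<mu> A) \<in> borel_measurable ?G"
      proof (rule measurable_cong)
        fix \<mu> assume "\<mu> \<in> space ?G"
        then have \<mu>: "\<mu> \<in> counting_measures" unfolding spG by (rule counting_measures_if_space_CM)
        note [simp] = counting_measuresD(1,2)[OF this]
        obtain W :: "nat \<Rightarrow> 'a set" where
          W: "range W \<subseteq> \<V>" "incseq W" "(\<Union>n. W n) = UNIV" "\<And>n. emeasure \<mu> (W n) < \<infinity>"
          using exh[OF \<mu>] by metis
        have Wb: "W n \<in> sets borel" for n using W(1) Vb by auto
        show "(SUP V\<in>\<V>. ?e V A \<mu>) = emeasure \<mu> A"
        proof (rule antisym)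
          show "(SUP V\<in>\<V>. ?e V A \<mu>) \<le> emeasure \<mu> A"
            using A by (intro SUP_least) (auto intro!: emeasure_mono)
          have "emeasure \<mu> A = emeasure \<mu> (\<Union>n. A \<inter> W n)"
            using W(3) by (simp flip: Int_UN_distrib)
          also have "\<dots> = (SUP n. emeasure \<mu> (A \<inter> W n))"
            using A Wb W(2) by (intro SUP_emeasure_incseq[symmetric]) (auto simp: incseq_def)
          also have "\<dots> = (SUP n. ?e (W n) A \<mu>)"
            using W(4) by simp
          also have "\<dots> \<le> (SUP V\<in>\<V>. ?e V A \<mu>)"
            by (rule SUP_mono) (use W(1) in blast)
          finally show "emeasure \<mu> A \<le> (SUP V\<in>\<V>. ?e V A \<mu>)" .
        qed
      qed
      finally show "(\<lambda>\<mu>. emeasure \<mu> A) \<in> borel_measurable ?G" .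
    qed
    then have "(\<lambda>\<mu>. \<mu>) -` L \<inter> space ?G \<in> sets ?G" if "L \<in> sets CM" for L
      using that by (rule measurable_sets)
    then show "sets CM \<subseteq> sigma_sets ?\<Omega> E"
      unfolding spG sG using sets.sets_into_space[where M="CM :: 'a measure measure"]
      by (auto simp: Int_absorb2)
  qed
  ultimately show thesis by (rule that)
qed

text \<open>The sets of finite mass for \<open>M\<close> and those for \<open>N\<close> are
  unrelated; their pairwise intersections are finite for both and still cover the space.\<close>

lemma sigma_finite_add_measure:
  assumes sets: "sets M = sets N" and M: "sigma_finite_measure M" and N: "sigma_finite_measure N"
  shows "sigma_finite_measure (M \<oplus>\<^sub>M N)"
proof -
  obtain A where A: "countable A" "A \<subseteq> sets M" "\<Union>A = space M" "\<And>a. a \<in> A \<Longrightarrow> emeasure M a \<noteq> \<infinity>"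
    using sigma_finite_measure.sigma_finite_countable[OF M] by metis
  obtain B where B: "countable B" "B \<subseteq> sets N" "\<Union>B = space N" "\<And>b. b \<in> B \<Longrightarrow> emeasure N b \<noteq> \<infinity>"
    using sigma_finite_measure.sigma_finite_countable[OF N] by metis
  let ?C = "(\<lambda>(a, b). a \<inter> b) ` (A \<times> B)"
  have sp: "space M = space N" using sets by (rule sets_eq_imp_space_eq)
  show ?thesis
  proof (intro sigma_finite_measure.intro exI[of _ ?C] conjI)
    show "countable ?C" using A(1) B(1) by auto
    show "?C \<subseteq> sets (M \<oplus>\<^sub>M N)" using A(2) B(2) sets by auto
    show "\<Union>?C = space (M \<oplus>\<^sub>M N)"
    proof -
      have "\<Union>?C = \<Union>A \<inter> \<Union>B" by auto
      then show ?thesis using A(3) B(3) sp by simp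
    qed
    show "\<forall>c\<in>?C. emeasure (M \<oplus>\<^sub>M N) c \<noteq> \<infinity>"
    proof
      fix c assume "c \<in> ?C"
      then obtain a b where c: "c = a \<inter> b" "a \<in> A" "b \<in> B" by auto
      have s: "a \<in> sets M" "b \<in> sets M" using c A(2) B(2) sets by auto
      have "emeasure M c \<le> emeasure M a" "emeasure N c \<le> emeasure N b"
        unfolding c(1) using s sets by (auto intro!: emeasure_mono)
      then have "emeasure M c \<noteq> \<infinity>" "emeasure N c \<noteq> \<infinity>"
        using A(4)[OF c(2)] B(4)[OF c(3)] by (auto simp: top_unique)
      then show "emeasure (M \<oplus>\<^sub>M N) c \<noteq> \<infinity>"
        using s c by (simp add: emeasure_add_measure[OF sets])
    qed
  qed
qed

text \<open>In the third term the first coordinate stems from \<open>\<Phi>2\<close>, hence the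
  order of the factors in its product measure. The terms whose first point comes from
  \<open>\<Phi>2\<close> are those whose first point comes from \<open>\<Phi>1\<close> with the
  processes exchanged; commutativity of independent sums restores the order of the summands.\<close>

lemma nn_integral_superposition:
  fixes \<Phi>1 \<Phi>2 :: "'w \<Rightarrow> 'a::polish_space measure"
  assumes pp: "point_process P \<Phi>1" "point_process P \<Phi>2"
    and indep: "prob_space.indep_var P CM \<Phi>1 CM \<Phi>2"
    and sf: "sigma_finite_measure (moment_measure P \<Phi>1)" "sigma_finite_measure (moment_measure P \<Phi>2)"
    and sf2: "sigma_finite_measure (second_factorial_moment_measure P \<Phi>1)"
      "sigma_finite_measure (second_factorial_moment_measure P \<Phi>2)"
    and K: "is_palm_kernel P \<Phi>1 K1" "is_palm_kernel P \<Phi>2 K2"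
    and R: "is_reduced_palm_kernel2 P \<Phi>1 R1" "is_reduced_palm_kernel2 P \<Phi>2 R2"
    and g[measurable]: "(\<lambda>(z, \<mu>). g z \<mu>) \<in> borel_measurable (borel \<Otimes>\<^sub>M CM)"
  shows "(\<integral>\<^sup>+\<omega>. \<integral>\<^sup>+z. g z (remove_pair z (\<Phi>1 \<omega> \<oplus>\<^sub>M \<Phi>2 \<omega>)) \<partial>second_factorial_measure (\<Phi>1 \<omega> \<oplus>\<^sub>M \<Phi>2 \<omega>) \<partial>P)
    = (\<integral>\<^sup>+z. \<integral>\<^sup>+\<mu>. g z \<mu> \<partial>indep_sum_law (R1 z) (distr P CM \<Phi>2) \<partial>second_factorial_moment_measure P \<Phi>1)
    + (\<integral>\<^sup>+z. \<integral>\<^sup>+\<mu>. g z \<mu> \<partial>indep_sum_law (reduced_palm K1 (fst z)) (reduced_palm K2 (snd z))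
        \<partial>(moment_measure P \<Phi>1 \<Otimes>\<^sub>M moment_measure P \<Phi>2))
    + (\<integral>\<^sup>+z. \<integral>\<^sup>+\<mu>. g z \<mu> \<partial>indep_sum_law (reduced_palm K1 (snd z)) (reduced_palm K2 (fst z))
        \<partial>(moment_measure P \<Phi>2 \<Otimes>\<^sub>M moment_measure P \<Phi>1))
    + (\<integral>\<^sup>+z. \<integral>\<^sup>+\<mu>. g z \<mu> \<partial>indep_sum_law (distr P CM \<Phi>1) (R2 z) \<partial>second_factorial_moment_measure P \<Phi>2)"
proof -
  have \<Phi>[measurable]: "\<Phi>1 \<in> P \<rightarrow>\<^sub>M CM" "\<Phi>2 \<in> P \<rightarrow>\<^sub>M CM" and "prob_space P"
    using pp by (simp_all add: point_process_def)
  interpret P: prob_space P by fact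
  let ?Q1 = "distr P CM \<Phi>1" and ?Q2 = "distr P CM \<Phi>2"
  interpret Q1: prob_space ?Q1 by (rule P.prob_space_distr) measurable
  interpret Q2: prob_space ?Q2 by (rule P.prob_space_distr) measurable
  interpret Q: pair_sigma_finite ?Q1 ?Q2 ..
  have Qp: "?Q1 \<in> space (prob_algebra CM)" "?Q2 \<in> space (prob_algebra CM)"
    using Q1.prob_space_axioms Q2.prob_space_axioms by (simp_all add: space_prob_algebra)
  have Rm: "R1 \<in> borel \<rightarrow>\<^sub>M prob_algebra CM" "R2 \<in> borel \<rightarrow>\<^sub>M prob_algebra CM"
    using R by (simp_all add: is_reduced_palm_kernel2_def)
  have Km[measurable]: "K1 \<in> borel \<rightarrow>\<^sub>M prob_algebra CM" "K2 \<in> borel \<rightarrow>\<^sub>M prob_algebra CM"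
    using K by (simp_all add: is_palm_kernel_def)
  have R2z: "R2 z \<in> space (prob_algebra CM)" for z using measurable_space[OF Rm(2)] by simp
  have "reduced_palm K1 \<in> borel \<rightarrow>\<^sub>M prob_algebra CM" "reduced_palm K2 \<in> borel \<rightarrow>\<^sub>M prob_algebra CM"
    by measurable
  from this[THEN measurable_space]
  have Kx: "reduced_palm K1 x \<in> space (prob_algebra CM)" "reduced_palm K2 x \<in> space (prob_algebra CM)" for x
    by simp_all
  let ?G = "\<lambda>\<mu>. \<integral>\<^sup>+z. g z (remove_pair z \<mu>) \<partial>second_factorial_measure \<mu>"
  let ?F1 = "\<lambda>\<mu> \<nu>. \<integral>\<^sup>+z. g z (remove_pair z \<mu> \<oplus>\<^sub>M \<nu>) \<partial>second_factorial_measure \<mu>"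
  let ?F2 = "\<lambda>\<mu> \<nu>. \<integral>\<^sup>+x. \<integral>\<^sup>+y. g (x, y) (remove_point x \<mu> \<oplus>\<^sub>M remove_point y \<nu>) \<partial>\<nu> \<partial>\<mu>"
  have Gm: "?G \<in> borel_measurable CM"
    by (rule nn_integral_measurable_second_factorial) measurable
  have F1m: "(\<lambda>w. ?F1 (a w) (b w)) \<in> borel_measurable N"
    if [measurable]: "a \<in> N \<rightarrow>\<^sub>M CM" "b \<in> N \<rightarrow>\<^sub>M CM" for a b and N :: "('a measure \<times> 'a measure) measure"
    by (rule nn_integral_measurable_second_factorial) measurable
  have F2m: "(\<lambda>w. ?F2 (a w) (b w)) \<in> borel_measurable N"
    if [measurable]: "a \<in> N \<rightarrow>\<^sub>M CM" "b \<in> N \<rightarrow>\<^sub>M CM" for a b and N :: "('a measure \<times> 'a measure) measure"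
  proof (rule nn_integral_measurable_CM[OF that(1)])
    have "(\<lambda>p. \<integral>\<^sup>+y. g (snd p, y) (remove_point (snd p) (a (fst p)) \<oplus>\<^sub>M remove_point y (b (fst p))) \<partial>b (fst p))
        \<in> borel_measurable (N \<Otimes>\<^sub>M borel)"
      by (rule nn_integral_measurable_CM) measurable
    then show "(\<lambda>(w, x). \<integral>\<^sup>+y. g (x, y) (remove_point x (a w) \<oplus>\<^sub>M remove_point y (b w)) \<partial>b w)
        \<in> borel_measurable (N \<Otimes>\<^sub>M borel)"
      by (simp add: case_prod_beta')
  qed
  let ?QQ = "?Q1 \<Otimes>\<^sub>M ?Q2"
  have fm[measurable]: "fst \<in> ?QQ \<rightarrow>\<^sub>M CM" "snd \<in> ?QQ \<rightarrow>\<^sub>M CM" by measurable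
  have split: "?G (\<mu> \<oplus>\<^sub>M \<nu>) = ?F1 \<mu> \<nu> + ?F2 \<mu> \<nu> + ?F2 \<nu> \<mu> + ?F1 \<nu> \<mu>"
    if \<mu>: "\<mu> \<in> space CM" and \<nu>: "\<nu> \<in> space CM" for \<mu> \<nu> :: "'a measure"
  proof -
    note c = counting_measures_if_space_CM[OF \<mu>] counting_measures_if_space_CM[OF \<nu>]
    note [simp] = counting_measuresD(1)[OF c(1)] counting_measuresD(1)[OF c(2)]
    have "remove_point y \<mu> \<oplus>\<^sub>M remove_point x \<nu> = remove_point x \<nu> \<oplus>\<^sub>M remove_point y \<mu>"
      "\<mu> \<oplus>\<^sub>M remove_pair z \<nu> = remove_pair z \<nu> \<oplus>\<^sub>M \<mu>" for x y z
      by (simp_all add: add_measure_commute remove_pair_def)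
    then show ?thesis
      by (simp add: nn_integral_remove_pair_add[OF c g])
  qed
  \<comment> \<open>Independence enters here, by replacing the joint law of the two processes with
    the product of their laws. In each term the order of integration is then chosen so that the law
    to which a Palm formula is applied first is the inner one.\<close>
  have "distr P (CM \<Otimes>\<^sub>M CM) (\<lambda>\<omega>. (\<Phi>1 \<omega>, \<Phi>2 \<omega>)) = ?QQ"
    using indep by (simp add: P.indep_var_distribution_eq)
  note law = this[symmetric]
  have "(\<integral>\<^sup>+\<omega>. ?G (\<Phi>1 \<omega> \<oplus>\<^sub>M \<Phi>2 \<omega>) \<partial>P) = (\<integral>\<^sup>+p. ?G (fst p \<oplus>\<^sub>M snd p) \<partial>?QQ)"
    unfolding law
  proof (subst nn_integral_distr)
    show "(\<lambda>p. ?G (fst p \<oplus>\<^sub>M snd p)) \<in> borel_measurable (distr P (CM \<Otimes>\<^sub>M CM) (\<lambda>\<omega>. (\<Phi>1 \<omega>, \<Phi>2 \<omega>)))"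
      by (rule measurable_compose[OF _ Gm]) measurable
  qed simp_all
  also have "\<dots> = (\<integral>\<^sup>+p. ?F1 (fst p) (snd p) + ?F2 (fst p) (snd p) + ?F2 (snd p) (fst p) + ?F1 (snd p) (fst p) \<partial>?QQ)"
    by (intro nn_integral_cong split) (auto simp: space_pair_measure)
  also have "\<dots> = (\<integral>\<^sup>+p. ?F1 (fst p) (snd p) \<partial>?QQ) + (\<integral>\<^sup>+p. ?F2 (fst p) (snd p) \<partial>?QQ)
      + (\<integral>\<^sup>+p. ?F2 (snd p) (fst p) \<partial>?QQ) + (\<integral>\<^sup>+p. ?F1 (snd p) (fst p) \<partial>?QQ)"
    by (subst nn_integral_add, (intro borel_measurable_add F1m F2m fm)+)+ (rule refl)
  also have "(\<integral>\<^sup>+p. ?F1 (fst p) (snd p) \<partial>?QQ) = (\<integral>\<^sup>+\<nu>. \<integral>\<^sup>+\<mu>. ?F1 \<mu> \<nu> \<partial>?Q1 \<partial>?Q2)"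
    using Q.nn_integral_snd[OF F1m[OF fm]] by simp
  also have "\<dots> = (\<integral>\<^sup>+z. \<integral>\<^sup>+\<mu>. g z \<mu> \<partial>indep_sum_law (R1 z) ?Q2 \<partial>second_factorial_moment_measure P \<Phi>1)"
    by (rule nn_integral_reduced_palm_pair_add[OF pp(1) sf2(1) R(1) Qp(2) g])
  also have "(\<integral>\<^sup>+p. ?F2 (fst p) (snd p) \<partial>?QQ) = (\<integral>\<^sup>+\<nu>. \<integral>\<^sup>+\<mu>. ?F2 \<mu> \<nu> \<partial>?Q1 \<partial>?Q2)"
    using Q.nn_integral_snd[OF F2m[OF fm]] by simp
  also have "\<dots> = (\<integral>\<^sup>+z. \<integral>\<^sup>+\<mu>. g z \<mu> \<partial>indep_sum_law (reduced_palm K1 (fst z)) (reduced_palm K2 (snd z))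
        \<partial>(moment_measure P \<Phi>1 \<Otimes>\<^sub>M moment_measure P \<Phi>2))"
    by (rule nn_integral_reduced_palms_add[OF pp sf K g])
  also have "(\<integral>\<^sup>+p. ?F2 (snd p) (fst p) \<partial>?QQ) = (\<integral>\<^sup>+\<mu>. \<integral>\<^sup>+\<nu>. ?F2 \<nu> \<mu> \<partial>?Q2 \<partial>?Q1)"
    using Q2.nn_integral_fst[OF F2m[OF fm(2,1)]] by simp
  also have "\<dots> = (\<integral>\<^sup>+z. \<integral>\<^sup>+\<mu>. g z \<mu> \<partial>indep_sum_law (reduced_palm K2 (fst z)) (reduced_palm K1 (snd z))
        \<partial>(moment_measure P \<Phi>2 \<Otimes>\<^sub>M moment_measure P \<Phi>1))"
    by (rule nn_integral_reduced_palms_add[OF pp(2,1) sf(2,1) K(2,1) g])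
  also have "\<dots> = (\<integral>\<^sup>+z. \<integral>\<^sup>+\<mu>. g z \<mu> \<partial>indep_sum_law (reduced_palm K1 (snd z)) (reduced_palm K2 (fst z))
        \<partial>(moment_measure P \<Phi>2 \<Otimes>\<^sub>M moment_measure P \<Phi>1))"
    by (simp only: indep_sum_law_commute[OF Kx(2) Kx(1)])
  also have "(\<integral>\<^sup>+p. ?F1 (snd p) (fst p) \<partial>?QQ) = (\<integral>\<^sup>+\<mu>. \<integral>\<^sup>+\<nu>. ?F1 \<nu> \<mu> \<partial>?Q2 \<partial>?Q1)"
    using Q2.nn_integral_fst[OF F1m[OF fm(2,1)]] by simp
  also have "\<dots> = (\<integral>\<^sup>+z. \<integral>\<^sup>+\<mu>. g z \<mu> \<partial>indep_sum_law (R2 z) ?Q1 \<partial>second_factorial_moment_measure P \<Phi>2)"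
    by (rule nn_integral_reduced_palm_pair_add[OF pp(2) sf2(2) R(2) Qp(1) g])
  also have "\<dots> = (\<integral>\<^sup>+z. \<integral>\<^sup>+\<mu>. g z \<mu> \<partial>indep_sum_law ?Q1 (R2 z) \<partial>second_factorial_moment_measure P \<Phi>2)"
    by (simp only: indep_sum_law_commute[OF R2z Qp(1)])
  finally show ?thesis .
qed

section \<open>Identification of the two-point Palm kernel of the superposition\<close>

lemma measurable_emeasure_kernel:
  "k \<in> N \<rightarrow>\<^sub>M subprob_algebra M \<Longrightarrow> L \<in> sets M \<Longrightarrow> (\<lambda>w. emeasure (k w) L) \<in> borel_measurable N"
  by (rule measurable_compose[OF _ measurable_emeasure_subprob_algebra])

text \<open>The mixture is encoded as the sum of the four component laws scaled by the weights, so a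
  component with weight 0 drops out by itself. The kernels are arbitrary versions, and the equations
  for \<open>density\<close> make the weights derivatives with respect to
  \<open>\<nu>\<close>.\<close>

theorem corollary2:
  fixes P :: "'w measure"
    and \<Phi>1 \<Phi>2 :: "'w \<Rightarrow> 'a::polish_space measure"
    and \<nu>1 \<nu>2 \<nu>3 \<nu>4 \<nu> :: "('a \<times> 'a) measure"
    and q1 q2 q3 q4 :: "'a \<times> 'a \<Rightarrow> real"
    and K1 K2 :: "'a \<Rightarrow> 'a measure measure"
    and R1 R2 R12 :: "'a \<times> 'a \<Rightarrow> 'a measure measure"
  assumes "point_process P \<Phi>1" and "point_process P \<Phi>2"
    and "prob_space.indep_var P counting_measure_algebra \<Phi>1 counting_measure_algebra \<Phi>2"
    and "sigma_finite_measure (moment_measure P \<Phi>1)"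
    and "sigma_finite_measure (moment_measure P \<Phi>2)"
    and "sigma_finite_measure (second_factorial_moment_measure P \<Phi>1)"
    and "sigma_finite_measure (second_factorial_moment_measure P \<Phi>2)"
    and "\<nu>1 = second_factorial_moment_measure P \<Phi>1"
    and "\<nu>2 = moment_measure P \<Phi>1 \<Otimes>\<^sub>M moment_measure P \<Phi>2"
    and "\<nu>3 = moment_measure P \<Phi>2 \<Otimes>\<^sub>M moment_measure P \<Phi>1"
    and "\<nu>4 = second_factorial_moment_measure P \<Phi>2"
    and "\<nu> = \<nu>1 \<oplus>\<^sub>M \<nu>2 \<oplus>\<^sub>M \<nu>3 \<oplus>\<^sub>M \<nu>4"
    and "q1 \<in> borel_measurable borel" and "q2 \<in> borel_measurable borel"
    and "q3 \<in> borel_measurable borel" and "q4 \<in> borel_measurable borel"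
    and "\<And>z. q1 z \<ge> 0" and "\<And>z. q2 z \<ge> 0" and "\<And>z. q3 z \<ge> 0" and "\<And>z. q4 z \<ge> 0"
    and "\<And>z. q1 z + q2 z + q3 z + q4 z = 1"
    and "density \<nu> q1 = \<nu>1" and "density \<nu> q2 = \<nu>2"
    and "density \<nu> q3 = \<nu>3" and "density \<nu> q4 = \<nu>4"
    and "is_palm_kernel P \<Phi>1 K1" and "is_palm_kernel P \<Phi>2 K2"
    and "is_reduced_palm_kernel2 P \<Phi>1 R1" and "is_reduced_palm_kernel2 P \<Phi>2 R2"
    and "is_reduced_palm_kernel2 P (\<lambda>\<omega>. \<Phi>1 \<omega> \<oplus>\<^sub>M \<Phi>2 \<omega>) R12"
  shows "\<nu> = second_factorial_moment_measure P (\<lambda>\<omega>. \<Phi>1 \<omega> \<oplus>\<^sub>M \<Phi>2 \<omega>) \<and>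
    (AE (x, y) in \<nu>. R12 (x, y) =
       scale_measure (q1 (x, y))
         (indep_sum_law (R1 (x, y)) (distr P counting_measure_algebra \<Phi>2))
       \<oplus>\<^sub>M scale_measure (q2 (x, y)) (indep_sum_law (reduced_palm K1 x) (reduced_palm K2 y))
       \<oplus>\<^sub>M scale_measure (q3 (x, y)) (indep_sum_law (reduced_palm K1 y) (reduced_palm K2 x))
       \<oplus>\<^sub>M scale_measure (q4 (x, y))
         (indep_sum_law (distr P counting_measure_algebra \<Phi>1) (R2 (x, y))))"
proof -
  have pp: "point_process P \<Phi>1" "point_process P \<Phi>2" by fact+
  have \<Phi>[measurable]: "\<Phi>1 \<in> P \<rightarrow>\<^sub>M CM" "\<Phi>2 \<in> P \<rightarrow>\<^sub>M CM" and "prob_space P"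
    using pp by (simp_all add: point_process_def)
  interpret P: prob_space P by fact
  let ?\<Phi> = "\<lambda>\<omega>. \<Phi>1 \<omega> \<oplus>\<^sub>M \<Phi>2 \<omega>"
  let ?Q1 = "distr P CM \<Phi>1" and ?Q2 = "distr P CM \<Phi>2"
  let ?m = "second_factorial_moment_measure P ?\<Phi>"
  define l1 where "l1 z = indep_sum_law (R1 z) ?Q2" for z
  define l2 where "l2 z = indep_sum_law (reduced_palm K1 (fst z)) (reduced_palm K2 (snd z))" for z
  define l3 where "l3 z = indep_sum_law (reduced_palm K1 (snd z)) (reduced_palm K2 (fst z))" for z
  define l4 where "l4 z = indep_sum_law ?Q1 (R2 z)" for z
  note l_defs = l1_def l2_def l3_def l4_def
  have kernels [measurable]: "K1 \<in> borel \<rightarrow>\<^sub>M prob_algebra CM" "K2 \<in> borel \<rightarrow>\<^sub>M prob_algebra CM"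
    "R1 \<in> borel \<rightarrow>\<^sub>M prob_algebra CM" "R2 \<in> borel \<rightarrow>\<^sub>M prob_algebra CM"
    "R12 \<in> borel \<rightarrow>\<^sub>M prob_algebra CM"
    using \<open>is_palm_kernel P \<Phi>1 K1\<close> \<open>is_palm_kernel P \<Phi>2 K2\<close> \<open>is_reduced_palm_kernel2 P \<Phi>1 R1\<close>
      \<open>is_reduced_palm_kernel2 P \<Phi>2 R2\<close> \<open>is_reduced_palm_kernel2 P ?\<Phi> R12\<close>
    by (simp_all add: is_palm_kernel_def is_reduced_palm_kernel2_def)
  have "?Q1 \<in> space (prob_algebra CM)" "?Q2 \<in> space (prob_algebra CM)"
    using P.prob_space_distr[OF \<Phi>(1)] P.prob_space_distr[OF \<Phi>(2)] by (simp_all add: space_prob_algebra)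
  then have [measurable]: "(\<lambda>_. ?Q1) \<in> (borel :: ('a \<times> 'a) measure) \<rightarrow>\<^sub>M prob_algebra CM"
    "(\<lambda>_. ?Q2) \<in> (borel :: ('a \<times> 'a) measure) \<rightarrow>\<^sub>M prob_algebra CM"
    by simp_all
  have l: "l1 \<in> borel \<rightarrow>\<^sub>M prob_algebra CM" "l2 \<in> borel \<rightarrow>\<^sub>M prob_algebra CM"
    "l3 \<in> borel \<rightarrow>\<^sub>M prob_algebra CM" "l4 \<in> borel \<rightarrow>\<^sub>M prob_algebra CM"
    unfolding l_defs by measurable
  have lz: "l1 z \<in> space (prob_algebra CM)" "l2 z \<in> space (prob_algebra CM)"
    "l3 z \<in> space (prob_algebra CM)" "l4 z \<in> space (prob_algebra CM)"
    "R12 z \<in> space (prob_algebra CM)" for z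
    using l[THEN measurable_space] measurable_space[OF kernels(5)] by simp_all
  note lsets = lz[THEN prob_algebraD(1)]
  note lm = l[THEN measurable_prob_algebraD, THEN measurable_emeasure_kernel]
    kernels(5)[THEN measurable_prob_algebraD, THEN measurable_emeasure_kernel]
  have nu_sets: "sets \<nu>1 = sets borel" "sets \<nu>2 = sets borel" "sets \<nu>3 = sets borel" "sets \<nu>4 = sets borel"
  proof -
    have pair: "sets (moment_measure P \<Phi> \<Otimes>\<^sub>M moment_measure P \<Psi>) = sets (borel :: ('a \<times> 'a) measure)"
      for \<Phi> \<Psi> :: "'w \<Rightarrow> 'a measure"
      unfolding borel_prod[symmetric] by (intro sets_pair_measure_cong) simp_all
    show "sets \<nu>2 = sets borel" "sets \<nu>3 = sets borel"
      unfolding assms(9,10) by (rule pair)+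
    show "sets \<nu>1 = sets borel" "sets \<nu>4 = sets borel"
      unfolding assms(8,11) by simp_all
  qed
  have nu_e: "emeasure \<nu> A = emeasure \<nu>1 A + emeasure \<nu>2 A + emeasure \<nu>3 A + emeasure \<nu>4 A"
    if "A \<in> sets borel" for A
    using that unfolding assms(12) by (simp add: emeasure_add_measure nu_sets)
  have sets_nu[measurable_cong]: "sets \<nu> = sets borel" unfolding assms(12) by (simp add: nu_sets)
  have super: "(\<integral>\<^sup>+\<omega>. \<integral>\<^sup>+z. g z (remove_pair z (?\<Phi> \<omega>)) \<partial>second_factorial_measure (?\<Phi> \<omega>) \<partial>P)
    = (\<integral>\<^sup>+z. \<integral>\<^sup>+\<mu>. g z \<mu> \<partial>l1 z \<partial>\<nu>1) + (\<integral>\<^sup>+z. \<integral>\<^sup>+\<mu>. g z \<mu> \<partial>l2 z \<partial>\<nu>2)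
    + (\<integral>\<^sup>+z. \<integral>\<^sup>+\<mu>. g z \<mu> \<partial>l3 z \<partial>\<nu>3) + (\<integral>\<^sup>+z. \<integral>\<^sup>+\<mu>. g z \<mu> \<partial>l4 z \<partial>\<nu>4)"
    if "(\<lambda>(z, \<mu>). g z \<mu>) \<in> borel_measurable (borel \<Otimes>\<^sub>M CM)" for g
    unfolding l_defs assms(8-11)
    by (rule nn_integral_superposition[OF assms(1-7) assms(26-29) that])
  have m_eq: "?m = \<nu>"
  proof (rule measure_eqI)
    show "sets ?m = sets \<nu>" by (simp add: sets_nu)
    fix A assume "A \<in> sets ?m"
    then have A[measurable]: "A \<in> sets borel" by simp
    \<comment> \<open>An integrand that does not depend on the configuration is unchanged by the
      component laws, which have total mass 1.\<close>
    have const: "(\<integral>\<^sup>+\<mu>. indicator A z \<partial>Q) = indicator A z" if "Q \<in> space (prob_algebra CM)" for Q :: "'a measure measure" and z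
      using prob_space.emeasure_space_1[OF prob_algebraD(3)[OF that]] by simp
    have "emeasure ?m A = (\<integral>\<^sup>+\<omega>. emeasure (second_factorial_measure (?\<Phi> \<omega>)) A \<partial>P)"
      unfolding second_factorial_moment_measure_eq
    proof (rule emeasure_kernel_mixture)
      fix A :: "('a \<times> 'a) set" assume A[measurable]: "A \<in> sets borel"
      have "(\<lambda>\<omega>. \<integral>\<^sup>+z. indicator A z \<partial>second_factorial_measure (?\<Phi> \<omega>)) \<in> borel_measurable P"
        by (rule nn_integral_measurable_second_factorial) measurable
      then show "(\<lambda>\<omega>. emeasure (second_factorial_measure (?\<Phi> \<omega>)) A) \<in> borel_measurable P"
        using A by simp
    qed (simp_all add: A)
    also have "\<dots> = (\<integral>\<^sup>+\<omega>. \<integral>\<^sup>+z. indicator A z \<partial>second_factorial_measure (?\<Phi> \<omega>) \<partial>P)"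
      using A by simp
    also have "\<dots> = emeasure \<nu>1 A + emeasure \<nu>2 A + emeasure \<nu>3 A + emeasure \<nu>4 A"
      using A by (subst super) (simp_all only: const[OF lz(1)] const[OF lz(2)] const[OF lz(3)] const[OF lz(4)]
          nn_integral_indicator nu_sets, measurable)
    finally show "emeasure ?m A = emeasure \<nu> A" using nu_e[OF A] by simp
  qed
  have sf: "sigma_finite_measure \<nu>1" "sigma_finite_measure \<nu>2" "sigma_finite_measure \<nu>3" "sigma_finite_measure \<nu>4"
    using assms(4-11) by (simp_all add: sigma_finite_pair_measure)
  \<comment> \<open>Sigma-finiteness of \<open>\<nu>\<close> is what allows equality of integrals
    over all Borel sets to be turned into equality almost everywhere below.\<close>
  interpret \<nu>: sigma_finite_measure \<nu>
    unfolding assms(12) using sf by (intro sigma_finite_add_measure) (simp_all add: nu_sets)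
  let ?mix = "\<lambda>z. scale_measure (q1 z) (l1 z) \<oplus>\<^sub>M scale_measure (q2 z) (l2 z)
    \<oplus>\<^sub>M scale_measure (q3 z) (l3 z) \<oplus>\<^sub>M scale_measure (q4 z) (l4 z)"
  have mix_sets: "sets (?mix z) = sets CM" for z by (simp add: lsets)
  have mix_e: "emeasure (?mix z) L = q1 z * emeasure (l1 z) L + q2 z * emeasure (l2 z) L
      + q3 z * emeasure (l3 z) L + q4 z * emeasure (l4 z) L" if "L \<in> sets CM" for L z
    using that by (simp add: emeasure_add_measure lsets)
  note q_meas[measurable] = assms(13-16)
  \<comment> \<open>For a fixed event both sides are densities with respect to \<open>\<nu>\<close>
    of the same measure on pairs, the expected number of pairs in a set whose removal leaves a
    configuration in \<open>L\<close>; the null set still depends on \<open>L\<close>.\<close>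
  have AE_L: "AE z in \<nu>. emeasure (R12 z) L = emeasure (?mix z) L" if L[measurable]: "L \<in> sets CM" for L
  proof -
    note [measurable] = lm[OF L]
    have "AE z in \<nu>. emeasure (R12 z) L = q1 z * emeasure (l1 z) L + q2 z * emeasure (l2 z) L
      + q3 z * emeasure (l3 z) L + q4 z * emeasure (l4 z) L"
    proof (rule \<nu>.density_unique2)
      fix A assume "A \<in> sets \<nu>"
      then have A[measurable]: "A \<in> sets borel" by (simp add: sets_nu)
      \<comment> \<open>Integrals against the single measures \<open>\<nu>1\<close>, ...,
        \<open>\<nu>4\<close> become integrals against \<open>\<nu>\<close> weighted by the
        corresponding density, so that the four terms can be added under one integral.\<close>
      have d: "(\<integral>\<^sup>+z. \<integral>\<^sup>+\<mu>. indicator A z * indicator L \<mu> \<partial>l z \<partial>M) = (\<integral>\<^sup>+z. q z * (emeasure (l z) L * indicator A z) \<partial>\<nu>)"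
        if l: "\<And>z. sets (l z) = sets CM" and [measurable]: "(\<lambda>z. emeasure (l z) L) \<in> borel_measurable borel" "q \<in> borel_measurable borel"
          and M: "density \<nu> (\<lambda>z. ennreal (q z)) = M" for l :: "'a \<times> 'a \<Rightarrow> 'a measure measure" and q :: "'a \<times> 'a \<Rightarrow> real" and M
      proof -
        have "(\<integral>\<^sup>+\<mu>. indicator A z * indicator L \<mu> \<partial>l z) = emeasure (l z) L * indicator A z" for z
          using L l[of z] by (simp add: nn_integral_cmult mult.commute)
        then have "(\<integral>\<^sup>+z. \<integral>\<^sup>+\<mu>. indicator A z * indicator L \<mu> \<partial>l z \<partial>M) = (\<integral>\<^sup>+z. emeasure (l z) L * indicator A z \<partial>M)"
          by simp
        also have "\<dots> = (\<integral>\<^sup>+z. q z * (emeasure (l z) L * indicator A z) \<partial>\<nu>)"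
          unfolding M[symmetric] by (rule nn_integral_density) measurable
        finally show ?thesis .
      qed
      have m: "(\<lambda>(z, \<mu>). indicator A z * indicator L \<mu> :: ennreal) \<in> borel_measurable (borel \<Otimes>\<^sub>M CM)"
        by measurable
      have "(\<integral>\<^sup>+z\<in>A. emeasure (R12 z) L \<partial>\<nu>)
        = (\<integral>\<^sup>+\<omega>. \<integral>\<^sup>+z. indicator A z * indicator L (remove_pair z (?\<Phi> \<omega>)) \<partial>second_factorial_measure (?\<Phi> \<omega>) \<partial>P)"
        using \<open>is_reduced_palm_kernel2 P ?\<Phi> R12\<close> A L
        by (simp add: is_reduced_palm_kernel2_def remove_pair_def m_eq mult.commute)
      also have "\<dots> = (\<integral>\<^sup>+z. q1 z * (emeasure (l1 z) L * indicator A z) \<partial>\<nu>)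
        + (\<integral>\<^sup>+z. q2 z * (emeasure (l2 z) L * indicator A z) \<partial>\<nu>)
        + (\<integral>\<^sup>+z. q3 z * (emeasure (l3 z) L * indicator A z) \<partial>\<nu>)
        + (\<integral>\<^sup>+z. q4 z * (emeasure (l4 z) L * indicator A z) \<partial>\<nu>)"
        using d[OF lsets(1) lm(1)[OF L] q_meas(1) assms(22)] d[OF lsets(2) lm(2)[OF L] q_meas(2) assms(23)]
          d[OF lsets(3) lm(3)[OF L] q_meas(3) assms(24)] d[OF lsets(4) lm(4)[OF L] q_meas(4) assms(25)]
        by (simp only: super[OF m])
      also have "\<dots> = (\<integral>\<^sup>+z. q1 z * (emeasure (l1 z) L * indicator A z) + q2 z * (emeasure (l2 z) L * indicator A z)
        + q3 z * (emeasure (l3 z) L * indicator A z) + q4 z * (emeasure (l4 z) L * indicator A z) \<partial>\<nu>)"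
        by (simp add: nn_integral_add)
      finally show "(\<integral>\<^sup>+z\<in>A. emeasure (R12 z) L \<partial>\<nu>)
        = (\<integral>\<^sup>+z\<in>A. (q1 z * emeasure (l1 z) L + q2 z * emeasure (l2 z) L
          + q3 z * emeasure (l3 z) L + q4 z * emeasure (l4 z) L) \<partial>\<nu>)"
        by (simp add: distrib_right mult.assoc)
    qed measurable
    then show ?thesis by (simp only: mix_e[OF L])
  qed
  obtain E :: "'a measure set set" where E: "countable E" "Int_stable E" "E \<subseteq> Pow (space CM)" "space CM \<in> E"
    "sets CM = sigma_sets (space CM) E"
    by (rule countable_generator_CM)
  have "AE z in \<nu>. \<forall>L\<in>E. emeasure (R12 z) L = emeasure (?mix z) L"
    using E(5) by (intro AE_ball_countable' AE_L E(1)) auto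
  then have "AE z in \<nu>. R12 z = ?mix z"
  proof (rule eventually_mono)
    fix z assume "\<forall>L\<in>E. emeasure (R12 z) L = emeasure (?mix z) L"
    \<comment> \<open>\<open>space CM\<close> belongs to \<open>E\<close> and has mass 1 under
      \<open>R12 z\<close>, so the constant sequence serves as the exhaustion by sets of finite
      mass.\<close>
    then show "R12 z = ?mix z"
      using E(4) prob_space.emeasure_space_1[OF prob_algebraD(3)[OF lz(5)], of z]
      by (intro measure_eqI_generator_eq[OF E(2,3) _ _ _, where A="\<lambda>_. space CM"])
        (auto simp: E(5)[symmetric] lsets mix_sets prob_algebraD(2)[OF lz(5)])
  qed
  then show ?thesis
    by (simp add: m_eq l_defs case_prod_beta')
qed

end
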